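(* Let $\Omega$ be a bounded, measurable set in $\mathbb{R}^d$. Let $v_0,\dots,v_{n-1}\in\mathbb{R}^d$ and let $s_0,\dots,s_{n-1}$ be $n$ distinct points in $\mathbb{Z}^k$. Define the finite set $$X=\{(v_j,s_j) : j=0,1,\ldots,n-1\}\subseteq\mathbb{R}^{d+k},$$ let $S=\{s_j : j=0,1,\ldots,n-1\}$, and let $\Omega'=\left(\Omega\times[0,1]^k\right)\oplus X\subset\mathbb{R}^{d+k}$. Then: (i) Suppose that $S$ tiles $\mathbb{Z}^k$ by translations. Then $\Omega'$ tiles $\mathbb{R}^{d+k}$ by translations if and only if $\Omega$ tiles $\mathbb{R}^d$ by translations. (ii) If $\Omega\subset\mathbb{R}^d$ and $S+[0,1]^k\subset\mathbb{R}^k$ are spectral, then $\Omega'$ is spectral in $\mathbb{R}^{d+k}$.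
   Context: A measurable set $\Omega\subset\mathbb{R}^m$ of finite, positive Lebesgue measure tiles $\mathbb{R}^m$ by translations if there is a countable set $A\subset\mathbb{R}^m$ such that the translates $\Omega+a$, $a\in A$, cover almost every point of $\mathbb{R}^m$ exactly once. A finite set $S\subset\mathbb{Z}^k$ tiles $\mathbb{Z}^k$ by translations if there is $T\subset\mathbb{Z}^k$ such that the sets $S+t$, $t\in T$, form a partition of $\mathbb{Z}^k$. A measurable set $\Omega\subset\mathbb{R}^m$ of positive, finite measure is spectral if there is a set $\Lambda\subset\mathbb{R}^m$ such that $\{e^{2\pi i\lambda\cdot x}\}_{\lambda\in\Lambda}$ is an orthogonal basis for $L^2(\Omega)$. The notation $\left(\Omega\times[0,1]^k\right)\oplus X$ denotes the Minkowski sum $\left(\Omega\times[0,1]^k\right)+X$, i.e. the union of the translates of $\Omega\times[0,1]^k$ by the elements of $X$; these translates are pairwise disjoint up to measure zero because the $s_j$ are distinct integer points. *)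

theory Defs
  imports "HOL-Analysis.Analysis"
begin

definition tiles_space :: "'a::euclidean_space set \<Rightarrow> bool" where
  "tiles_space \<Omega> \<longleftrightarrow>
     \<Omega> \<in> lmeasurable \<and> measure lebesgue \<Omega> > 0 \<and>
     (\<exists>A. countable A \<and> (AE x in lebesgue. \<exists>!a. a \<in> A \<and> x \<in> (+) a ` \<Omega>))"

definition tiles_lattice :: "(int ^ 'k) set \<Rightarrow> bool" where
  "tiles_lattice S \<longleftrightarrow>
     finite S \<and>
     (\<exists>T. disjoint_family_on (\<lambda>t. (+) t ` S) T \<and> (\<Union>t\<in>T. (+) t ` S) = UNIV)"

definition real_vec :: "int ^ 'k \<Rightarrow> real ^ 'k" where
  "real_vec z = (\<chi> i. real_of_int (z $ i))"

text \<open>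
  Elements of \<open>L\<^sup>2\<close> are represented by functions; equality almost everywhere is reflected
  by \<open>L2_norm M (\<lambda>x. f x - g x) = 0\<close>.
\<close>

definition L2_space :: "'a measure \<Rightarrow> ('a \<Rightarrow> complex) set" where
  "L2_space M = {f \<in> borel_measurable M. integrable M (\<lambda>x. (norm (f x))\<^sup>2)}"

definition L2_inner :: "'a measure \<Rightarrow> ('a \<Rightarrow> complex) \<Rightarrow> ('a \<Rightarrow> complex) \<Rightarrow> complex" where
  "L2_inner M f g = (\<integral>x. f x * cnj (g x) \<partial>M)"

definition L2_norm :: "'a measure \<Rightarrow> ('a \<Rightarrow> complex) \<Rightarrow> real" where
  "L2_norm M f = sqrt (\<integral>x. (norm (f x))\<^sup>2 \<partial>M)"

text \<open>
  Orthogonal basis in the Hilbert space sense: a family of nonzero, pairwise orthogonal vectors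
  whose finite linear combinations are dense.
\<close>

definition L2_orthogonal_basis :: "'a measure \<Rightarrow> 'i set \<Rightarrow> ('i \<Rightarrow> 'a \<Rightarrow> complex) \<Rightarrow> bool" where
  "L2_orthogonal_basis M I e \<longleftrightarrow>
     (\<forall>i\<in>I. e i \<in> L2_space M \<and> L2_norm M (e i) \<noteq> 0) \<and>
     pairwise (\<lambda>i j. L2_inner M (e i) (e j) = 0) I \<and>
     (\<forall>f\<in>L2_space M. \<forall>\<epsilon>>0. \<exists>J c. finite J \<and> J \<subseteq> I \<and>
        L2_norm M (\<lambda>x. f x - (\<Sum>i\<in>J. c i * e i x)) < \<epsilon>)"

definition char_exp :: "'a::euclidean_space \<Rightarrow> 'a \<Rightarrow> complex" where
  "char_exp l x = exp (2 * of_real pi * \<i> * of_real (l \<bullet> x))"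

definition spectral :: "'a::euclidean_space set \<Rightarrow> bool" where
  "spectral \<Omega> \<longleftrightarrow>
     \<Omega> \<in> lmeasurable \<and> measure lebesgue \<Omega> > 0 \<and>
     (\<exists>\<Lambda>. L2_orthogonal_basis (lebesgue_on \<Omega>) \<Lambda> char_exp)"

end

theory Submission
  imports Defs
begin

text \<open>
  Off the integer grid, the slice of \<open>\<Omega>'\<close> at height \<open>y\<close> is \<open>\<Omega> + v\<^sub>j\<close> if \<open>y\<close> lies in the unit cell
  of \<open>s\<^sub>j\<close>, and empty if \<open>y\<close> lies in no such cell.

  Tiling: if \<open>\<Omega> + A\<close> and \<open>S + T\<close> are tilings, so is \<open>\<Omega>' + (A \<times> T)\<close>, slice by slice. Conversely, by
  Fubini almost every slice of a tiling by \<open>\<Omega>'\<close> is a tiling by translates of \<open>\<Omega>\<close>.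

  Spectrality: if \<open>\<Lambda>\<close> is a spectrum of \<open>\<Omega>\<close> and \<open>\<Gamma>\<close> one of \<open>S + [0,1]\<^sup>k\<close>, then \<open>\<Lambda> \<times> \<Gamma>\<close> is a
  spectrum of \<open>\<Omega>'\<close>. Orthogonality follows since the shifts \<open>v\<^sub>j\<close> only contribute phases, and these
  are trivial when the first frequencies agree. For density, the indicator of \<open>E \<times> F\<close> with \<open>F\<close> inside
  the cell of \<open>s\<^sub>j\<close> is close to \<open>P(x - v\<^sub>j) 1\<^sub>F(y)\<close> with \<open>P\<close> a combination of exponentials from \<open>\<Lambda>\<close>;
  expanding \<open>P\<close>, each term is an exponential in \<open>x\<close> times a multiple of \<open>1\<^sub>F(y)\<close>, which exponentials
  from \<open>\<Gamma>\<close> approximate.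
\<close>

section \<open>Closed subspaces of \<open>L\<^sup>2\<close>\<close>

definition sq_int :: "'a measure \<Rightarrow> ('a \<Rightarrow> complex) \<Rightarrow> ennreal" where
  "sq_int M f = (\<integral>\<^sup>+x. ennreal ((norm (f x))\<^sup>2) \<partial>M)"

text \<open>
  Squared norms take extended values, so that closeness never holds merely because
  \<^const>\<open>L2_norm\<close> of a function that is not square integrable is \<open>0\<close>.
\<close>

definition L2_closure :: "'a measure \<Rightarrow> ('a \<Rightarrow> complex) set \<Rightarrow> ('a \<Rightarrow> complex) set" where
  "L2_closure M W = {f \<in> borel_measurable M.
     \<forall>\<epsilon>>0. \<exists>w\<in>W. sq_int M (\<lambda>x. f x - w x) < ennreal \<epsilon>}"

definition fun_span :: "'i set \<Rightarrow> ('i \<Rightarrow> 'a \<Rightarrow> complex) \<Rightarrow> ('a \<Rightarrow> complex) set" where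
  "fun_span I e = {\<lambda>x. \<Sum>i\<in>J. c i * e i x | J c. finite J \<and> J \<subseteq> I}"

section \<open>Arithmetic of extended squared norms\<close>

lemma norm_add_sq_le: "(norm (a + b :: 'a::real_normed_vector))\<^sup>2 \<le> 2 * (norm a)\<^sup>2 + 2 * (norm b)\<^sup>2"
proof -
  have "(norm (a + b))\<^sup>2 \<le> (norm a + norm b)\<^sup>2"
    by (simp add: norm_triangle_ineq power_mono)
  also have "\<dots> \<le> 2 * (norm a)\<^sup>2 + 2 * (norm b)\<^sup>2"
    using sum_squares_bound[of "norm a" "norm b"] by (simp add: power2_sum)
  finally show ?thesis .
qed

lemma sq_int_cong_AE: "AE x in M. f x = g x \<Longrightarrow> sq_int M f = sq_int M g"
  unfolding sq_int_def by (intro nn_integral_cong_AE) auto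

text \<open>The pointwise bound \<open>norm_add_sq_le\<close> replaces the triangle inequality, so
  no square roots of extended values occur. The price is a factor 2, which is why tolerances are
  later split into quarters.\<close>

lemma sq_int_add_le:
  assumes [measurable]: "f \<in> borel_measurable M" "g \<in> borel_measurable M"
  shows "sq_int M (\<lambda>x. f x + g x) \<le> 2 * sq_int M f + 2 * sq_int M g"
proof -
  have "sq_int M (\<lambda>x. f x + g x)
      \<le> (\<integral>\<^sup>+x. 2 * ennreal ((norm (f x))\<^sup>2) + 2 * ennreal ((norm (g x))\<^sup>2) \<partial>M)"
    unfolding sq_int_def
  proof (intro nn_integral_mono)
    fix x
    have "ennreal ((norm (f x + g x))\<^sup>2) \<le> ennreal (2 * (norm (f x))\<^sup>2 + 2 * (norm (g x))\<^sup>2)"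
      by (intro ennreal_leI norm_add_sq_le)
    also have "\<dots> = 2 * ennreal ((norm (f x))\<^sup>2) + 2 * ennreal ((norm (g x))\<^sup>2)"
      by (simp add: ennreal_plus ennreal_mult')
    finally show "ennreal ((norm (f x + g x))\<^sup>2)
        \<le> 2 * ennreal ((norm (f x))\<^sup>2) + 2 * ennreal ((norm (g x))\<^sup>2)" .
  qed
  also have "\<dots> = 2 * sq_int M f + 2 * sq_int M g"
    unfolding sq_int_def by (simp add: nn_integral_add nn_integral_cmult)
  finally show ?thesis .
qed

lemma sq_int_density_indicator:
  assumes [measurable]: "S \<in> sets borel" "h \<in> borel_measurable borel"
  shows "sq_int (density lborel (indicator S)) h = (\<integral>\<^sup>+x. indicator S x * ennreal ((norm (h x))\<^sup>2) \<partial>lborel)"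
  by (simp add: sq_int_def nn_integral_density)

lemma sq_int_cmult:
  assumes [measurable]: "f \<in> borel_measurable M"
  shows "sq_int M (\<lambda>x. c * f x) = ennreal ((norm c)\<^sup>2) * sq_int M f"
  unfolding sq_int_def
  by (simp add: norm_mult power_mult_distrib ennreal_mult nn_integral_cmult)

lemma sq_int_add_less:
  assumes "f \<in> borel_measurable M" "g \<in> borel_measurable M"
    and "sq_int M f < ennreal (\<epsilon> / 4)" "sq_int M g < ennreal (\<epsilon> / 4)" "\<epsilon> > 0"
  shows "sq_int M (\<lambda>x. f x + g x) < ennreal \<epsilon>"
proof -
  have "sq_int M (\<lambda>x. f x + g x) \<le> 2 * sq_int M f + 2 * sq_int M g"
    using assms by (intro sq_int_add_le)
  also have "\<dots> < 2 * ennreal (\<epsilon> / 4) + 2 * ennreal (\<epsilon> / 4)"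
    using assms by (intro add_strict_mono ennreal_mult_strict_left_mono) auto
  also have "\<dots> = ennreal \<epsilon>"
    using \<open>\<epsilon> > 0\<close> ennreal_mult'[of 2 "\<epsilon>/4"] ennreal_plus[of "\<epsilon>/2" "\<epsilon>/2"] by simp
  finally show ?thesis .
qed

text \<open>Only measurability and linearity are imposed, not square integrability. Spans can
  therefore also be interpreted over \<open>borel\<close>, where the locale just records that their
  members are Borel functions.\<close>

locale fun_subspace =
  fixes M :: "'a measure" and W :: "('a \<Rightarrow> complex) set"
  assumes W_measurable: "w \<in> W \<Longrightarrow> w \<in> borel_measurable M"
    and W_zero: "(\<lambda>x. 0) \<in> W"
    and W_add: "\<lbrakk>v \<in> W; w \<in> W\<rbrakk> \<Longrightarrow> (\<lambda>x. v x + w x) \<in> W"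
    and W_cmult: "w \<in> W \<Longrightarrow> (\<lambda>x. c * w x) \<in> W"
begin

abbreviation "cl \<equiv> L2_closure M W"

lemma closure_measurable: "f \<in> cl \<Longrightarrow> f \<in> borel_measurable M"
  by (simp add: L2_closure_def)

lemma closure_superset: "w \<in> W \<Longrightarrow> w \<in> cl"
  by (auto simp: L2_closure_def W_measurable sq_int_def intro!: bexI[of _ w])

text \<open>The closure is itself closed: an approximant of an approximant is an approximant. Most
  later membership proofs approximate by elements of \<open>cl\<close> and finish with this
  rule.\<close>

lemma closure_limit:
  assumes "f \<in> borel_measurable M"
    and "\<And>\<epsilon>. \<epsilon> > 0 \<Longrightarrow> \<exists>g\<in>cl. sq_int M (\<lambda>x. f x - g x) < ennreal \<epsilon>"
  shows "f \<in> cl"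
  unfolding L2_closure_def
proof (intro CollectI conjI allI impI)
  fix \<epsilon> :: real assume "\<epsilon> > 0"
  then obtain g where g: "g \<in> cl" "sq_int M (\<lambda>x. f x - g x) < ennreal (\<epsilon>/4)"
    using assms(2)[of "\<epsilon>/4"] by auto
  then obtain w where w: "w \<in> W" "sq_int M (\<lambda>x. g x - w x) < ennreal (\<epsilon>/4)"
    using \<open>\<epsilon> > 0\<close> unfolding L2_closure_def by (force dest: spec[of _ "\<epsilon>/4"])
  have "sq_int M (\<lambda>x. (f x - g x) + (g x - w x)) < ennreal \<epsilon>"
    using g w \<open>\<epsilon> > 0\<close> assms(1)
    by (intro sq_int_add_less borel_measurable_diff) (auto simp: closure_measurable W_measurable)
  then show "\<exists>w\<in>W. sq_int M (\<lambda>x. f x - w x) < ennreal \<epsilon>"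
    using w by auto
qed fact

lemma closure_cong_AE:
  assumes "g \<in> cl" "f \<in> borel_measurable M" "AE x in M. f x = g x"
  shows "f \<in> cl"
proof (rule closure_limit)
  fix \<epsilon> :: real assume "\<epsilon> > 0"
  have "sq_int M (\<lambda>x. f x - g x) = sq_int M (\<lambda>x. 0)"
    using assms(3) by (intro sq_int_cong_AE) auto
  also have "\<dots> < ennreal \<epsilon>"
    using \<open>\<epsilon> > 0\<close> by (simp add: sq_int_def)
  finally show "\<exists>g\<in>cl. sq_int M (\<lambda>x. f x - g x) < ennreal \<epsilon>"
    using assms(1) by blast
qed fact

lemma closure_add:
  assumes "f \<in> cl" "g \<in> cl"
  shows "(\<lambda>x. f x + g x) \<in> cl"
  unfolding L2_closure_def
proof (intro CollectI conjI allI impI)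
  show "(\<lambda>x. f x + g x) \<in> borel_measurable M"
    using assms by (intro borel_measurable_add closure_measurable)
  fix \<epsilon> :: real assume "\<epsilon> > 0"
  obtain v w where vw: "v \<in> W" "sq_int M (\<lambda>x. f x - v x) < ennreal (\<epsilon>/4)"
    "w \<in> W" "sq_int M (\<lambda>x. g x - w x) < ennreal (\<epsilon>/4)"
    using assms \<open>\<epsilon> > 0\<close> unfolding L2_closure_def by (force dest: spec[of _ "\<epsilon>/4"])
  have "sq_int M (\<lambda>x. (f x - v x) + (g x - w x)) < ennreal \<epsilon>"
    using vw \<open>\<epsilon> > 0\<close> assms
    by (intro sq_int_add_less borel_measurable_diff) (auto simp: closure_measurable W_measurable)
  then show "\<exists>w\<in>W. sq_int M (\<lambda>x. (f x + g x) - w x) < ennreal \<epsilon>"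
    using vw by (intro bexI[of _ "\<lambda>x. v x + w x"] W_add) (auto simp: algebra_simps)
qed

lemma closure_cmult:
  assumes "f \<in> cl"
  shows "(\<lambda>x. c * f x) \<in> cl"
  unfolding L2_closure_def
proof (intro CollectI conjI allI impI)
  have f: "f \<in> borel_measurable M" using assms by (rule closure_measurable)
  then show "(\<lambda>x. c * f x) \<in> borel_measurable M" by measurable
  fix \<epsilon> :: real assume "\<epsilon> > 0"
  \<comment> \<open>The \<open>+ 1\<close> covers \<open>c = 0\<close> and makes
    \<open>(norm c)\<^sup>2 * \<delta>\<close> strictly smaller than \<epsilon>.\<close>
  define \<delta> where "\<delta> = \<epsilon> / ((norm c)\<^sup>2 + 1)"
  have pos: "(norm c)\<^sup>2 + 1 > 0" using zero_le_power2[of "norm c"] by linarith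
  have "\<delta> > 0" using \<open>\<epsilon> > 0\<close> pos by (simp add: \<delta>_def)
  then obtain w where w: "w \<in> W" "sq_int M (\<lambda>x. f x - w x) < ennreal \<delta>"
    using assms unfolding L2_closure_def by auto
  have "(\<lambda>x. f x - w x) \<in> borel_measurable M"
    using f w W_measurable by (intro borel_measurable_diff) auto
  then have "sq_int M (\<lambda>x. c * (f x - w x)) = ennreal ((norm c)\<^sup>2) * sq_int M (\<lambda>x. f x - w x)"
    by (rule sq_int_cmult)
  also have "\<dots> \<le> ennreal ((norm c)\<^sup>2) * ennreal \<delta>"
    using w by (intro mult_left_mono) auto
  also have "\<dots> = ennreal ((norm c)\<^sup>2 * \<delta>)"
    using \<open>\<delta> > 0\<close> by (simp add: ennreal_mult)
  also have "\<dots> < ennreal \<epsilon>"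
    using \<open>\<epsilon> > 0\<close> pos by (intro ennreal_lessI) (auto simp: \<delta>_def field_simps)
  finally show "\<exists>w\<in>W. sq_int M (\<lambda>x. c * f x - w x) < ennreal \<epsilon>"
    using w by (intro bexI[of _ "\<lambda>x. c * w x"] W_cmult) (auto simp: algebra_simps)
qed

lemma closure_diff: "f \<in> cl \<Longrightarrow> g \<in> cl \<Longrightarrow> (\<lambda>x. f x - g x) \<in> cl"
  using closure_add[OF _ closure_cmult[of g "-1"], of f] by simp

lemma closure_sum: "(\<And>i. i \<in> J \<Longrightarrow> f i \<in> cl) \<Longrightarrow> (\<lambda>x. \<Sum>i\<in>J. f i x) \<in> cl"
  by (induction J rule: infinite_finite_induct)
    (simp_all add: closure_add closure_superset W_zero)

text \<open>Dominated convergence is applied to the squared errors, which tend to 0 pointwise;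
  accordingly the majorant bounds these errors and not the functions \<open>F i\<close>.\<close>

lemma closure_dominated:
  assumes F: "\<And>i. F i \<in> cl" and f[measurable]: "f \<in> borel_measurable M"
    and g[measurable]: "g \<in> borel_measurable M" and fin: "(\<integral>\<^sup>+x. ennreal (g x) \<partial>M) < \<infinity>"
    and lim: "\<And>x. x \<in> space M \<Longrightarrow> (\<lambda>i. F i x) \<longlonglongrightarrow> f x"
    and bound: "\<And>i x. x \<in> space M \<Longrightarrow> (norm (f x - F i x))\<^sup>2 \<le> g x"
  shows "f \<in> cl"
proof (rule closure_limit)
  fix \<epsilon> :: real assume "\<epsilon> > 0"
  have [measurable]: "F i \<in> borel_measurable M" for i using F by (rule closure_measurable)
  have "(\<lambda>i. \<integral>\<^sup>+x. ennreal ((norm (f x - F i x))\<^sup>2) \<partial>M) \<longlonglongrightarrow> (\<integral>\<^sup>+x. 0 \<partial>M)"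
  proof (rule nn_integral_dominated_convergence)
    show "AE x in M. (\<lambda>i. ennreal ((norm (f x - F i x))\<^sup>2)) \<longlonglongrightarrow> 0"
    proof (intro AE_I2)
      fix x assume "x \<in> space M"
      then have "(\<lambda>i. (norm (f x - F i x))\<^sup>2) \<longlonglongrightarrow> (norm (f x - f x))\<^sup>2"
        by (intro tendsto_intros lim)
      then show "(\<lambda>i. ennreal ((norm (f x - F i x))\<^sup>2)) \<longlonglongrightarrow> 0"
        by (auto simp flip: ennreal_0 intro!: tendsto_ennrealI)
    qed
  qed (use fin bound in \<open>auto intro!: AE_I2 ennreal_leI\<close>)
  then have "\<forall>\<^sub>F i in sequentially. sq_int M (\<lambda>x. f x - F i x) < ennreal \<epsilon>"
    using \<open>\<epsilon> > 0\<close> unfolding sq_int_def by (intro order_tendstoD(2)) auto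
  then obtain i where "sq_int M (\<lambda>x. f x - F i x) < ennreal \<epsilon>"
    by (auto simp: eventually_sequentially)
  with F show "\<exists>g\<in>cl. sq_int M (\<lambda>x. f x - g x) < ennreal \<epsilon>" by blast
qed fact

text \<open>Dynkin's \<pi>-\<lambda> argument: the sets with indicator in the closure admit
  complements, by subtraction from the whole space, and countable disjoint unions, as limits of
  partial sums. Finiteness of the measure makes the constant majorant 1 integrable.\<close>

lemma closure_indicator_sigma_sets:
  assumes "finite_measure M" "Int_stable G" "G \<subseteq> Pow (space M)"
    and sets: "sets M = sigma_sets (space M) G"
    and whole: "indicator (space M) \<in> cl" and G: "\<And>A. A \<in> G \<Longrightarrow> indicator A \<in> cl"
    and A: "A \<in> sets M"
  shows "indicator A \<in> cl"
proof -
  interpret finite_measure M by fact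
  have "A \<in> sigma_sets (space M) G" using A sets by simp
  with assms(2,3) show ?thesis
  proof (induction rule: sigma_sets_induct_disjoint)
    case (basic A) then show ?case by (rule G)
  next
    case empty
    have "indicator {} = (\<lambda>x. 0 :: complex)" by auto
    then show ?case using W_zero by (simp add: closure_superset)
  next
    case (compl A)
    then have [measurable]: "A \<in> sets M" by (simp add: sets)
    show ?case
      by (rule closure_cong_AE[OF closure_diff[OF whole compl(2)]])
        (auto intro!: AE_I2 split: split_indicator)
  next
    case (union A)
    then have [measurable]: "A i \<in> sets M" for i by (auto simp: sets)
    show ?case
    proof (rule closure_dominated)
      show "(\<lambda>x. \<Sum>j<i. indicator (A j) x) \<in> cl" for i :: nat
        using union by (intro closure_sum) auto
      show "(\<lambda>x. 1::real) \<in> borel_measurable M" by simp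
      show "(\<integral>\<^sup>+x. ennreal 1 \<partial>M) < \<infinity>" using emeasure_finite[of "space M"] by (simp add: less_top[symmetric])
      have *: "(\<Sum>j<i. indicator (A j) x) = (indicator (\<Union>j<i. A j) x :: complex)" for i :: nat and x
        using union(1) by (intro indicator_UN_disjoint[symmetric]) 
          (auto intro: disjoint_family_on_mono)
      show "(\<lambda>i. \<Sum>j<i. indicator (A j) x) \<longlonglongrightarrow> (indicator (\<Union>i. A i) x :: complex)" for x
        unfolding * by (rule LIMSEQ_indicator_UN)
      show "(norm (indicator (\<Union>i. A i) x - (\<Sum>j<i. indicator (A j) x) :: complex))\<^sup>2 \<le> 1" for i x
        unfolding * by (auto split: split_indicator)
    qed (auto intro: borel_measurable_indicator)
  qed
qed

text \<open>Simple functions are finite combinations of indicators, and every square integrable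
  function is a limit of simple functions with an integrable bound on the squared errors.\<close>

lemma closure_L2:
  assumes "finite_measure M" and ind: "\<And>A. A \<in> sets M \<Longrightarrow> indicator A \<in> cl"
    and f: "f \<in> L2_space M"
  shows "f \<in> cl"
proof -
  have [measurable]: "f \<in> borel_measurable M" and int: "integrable M (\<lambda>x. (norm (f x))\<^sup>2)"
    using f by (auto simp: L2_space_def)
  \<comment> \<open>Approximation relative to the base point 0 gives the bound
    \<open>2 * norm (f x)\<close>, hence errors of at most \<open>3 * norm (f x)\<close>. This is
    the origin of the constant 9 in the majorant.\<close>
  obtain F where F: "\<And>i. simple_function M (F i)" "\<And>x. x \<in> space M \<Longrightarrow> (\<lambda>i. F i x) \<longlonglongrightarrow> f x"
    "\<And>i x. x \<in> space M \<Longrightarrow> norm (F i x) \<le> 2 * norm (f x)"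
    using borel_measurable_implies_sequence_metric[of f M 0] by auto metis
  show ?thesis
  proof (rule closure_dominated)
    show "F i \<in> cl" for i
    proof (rule closure_cong_AE)
      show "(\<lambda>x. \<Sum>y\<in>F i ` space M. y * indicator (F i -` {y} \<inter> space M) x) \<in> cl"
        using F(1) by (intro closure_sum closure_cmult ind) (auto intro: simple_functionD)
      have indicator_scaleR: "indicator B x *\<^sub>R y = indicator B x * y" for B x and y :: complex
        by (simp split: split_indicator)
      show "AE x in M. F i x = (\<Sum>y\<in>F i ` space M. y * indicator (F i -` {y} \<inter> space M) x)"
        using simple_function_indicator_representation_AE[OF F(1)[of i]]
        unfolding indicator_scaleR by (simp only: mult.commute)
    qed (use F(1) borel_measurable_simple_function in blast)
    show "(\<lambda>x. 9 * (norm (f x))\<^sup>2) \<in> borel_measurable M" by measurable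
    have "integrable M (\<lambda>x. 9 * (norm (f x))\<^sup>2)" using int by simp
    then show "(\<integral>\<^sup>+x. ennreal (9 * (norm (f x))\<^sup>2) \<partial>M) < \<infinity>"
      by (simp add: nn_integral_eq_integral)
    show "(norm (f x - F i x))\<^sup>2 \<le> 9 * (norm (f x))\<^sup>2" if "x \<in> space M" for i x
    proof -
      have "norm (f x - F i x) \<le> 3 * norm (f x)"
        using F(3)[OF that, of i] norm_triangle_ineq4[of "f x" "F i x"] by linarith
      then have "(norm (f x - F i x))\<^sup>2 \<le> (3 * norm (f x))\<^sup>2" by (intro power_mono) auto
      then show ?thesis by (simp add: power_mult_distrib)
    qed
  qed (use F in auto)
qed

end

lemma fun_subspace_fun_span:
  assumes "\<And>i. i \<in> I \<Longrightarrow> e i \<in> borel_measurable M"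
  shows "fun_subspace M (fun_span I e)"
proof
  fix v w :: "'b \<Rightarrow> complex" and c
  show "w \<in> borel_measurable M" if "w \<in> fun_span I e"
  proof -
    obtain J c where "w = (\<lambda>x. \<Sum>i\<in>J. c i * e i x)" "J \<subseteq> I"
      using \<open>w \<in> fun_span I e\<close> by (auto simp: fun_span_def)
    then show ?thesis
      using assms by (auto intro!: borel_measurable_sum borel_measurable_times)
  qed
  show "(\<lambda>x. 0) \<in> fun_span I e"
    unfolding fun_span_def by (auto intro!: exI[of _ "{}"])
  show "(\<lambda>x. c * w x) \<in> fun_span I e" if "w \<in> fun_span I e"
  proof -
    obtain J d where "w = (\<lambda>x. \<Sum>i\<in>J. d i * e i x)" "finite J" "J \<subseteq> I"
      using \<open>w \<in> fun_span I e\<close> by (auto simp: fun_span_def)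
    then show ?thesis unfolding fun_span_def
      by (auto simp: sum_distrib_left mult.assoc intro!: exI[of _ J] exI[of _ "\<lambda>i. c * d i"])
  qed
  show "(\<lambda>x. v x + w x) \<in> fun_span I e" if vw: "v \<in> fun_span I e" "w \<in> fun_span I e"
  proof -
    obtain J c where J: "v = (\<lambda>x. \<Sum>i\<in>J. c i * e i x)" "finite J" "J \<subseteq> I"
      using vw by (auto simp: fun_span_def)
    obtain K d where K: "w = (\<lambda>x. \<Sum>i\<in>K. d i * e i x)" "finite K" "K \<subseteq> I"
      using vw by (auto simp: fun_span_def)
    \<comment> \<open>Both coefficient families are extended by zero to the common index set
      \<open>J \<union> K\<close>.\<close>
    define b where "b = (\<lambda>i. (if i \<in> J then c i else 0) + (if i \<in> K then d i else 0))"
    have "v x + w x = (\<Sum>i\<in>J \<union> K. b i * e i x)" for x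
    proof -
      have "v x = (\<Sum>i\<in>J \<union> K. (if i \<in> J then c i else 0) * e i x)"
        unfolding J(1) using J K by (intro sum.mono_neutral_cong_left) auto
      moreover have "w x = (\<Sum>i\<in>J \<union> K. (if i \<in> K then d i else 0) * e i x)"
        unfolding K(1) using J K by (intro sum.mono_neutral_cong_left) auto
      ultimately show ?thesis by (simp add: b_def sum.distrib distrib_right)
    qed
    then show ?thesis unfolding fun_span_def using J K
      by (auto intro!: exI[of _ "J \<union> K"] exI[of _ b])
  qed
qed

section \<open>Density in \<open>L2_norm\<close> and membership in \<open>L2_closure\<close>\<close>

lemma L2_space_iff: "f \<in> L2_space M \<longleftrightarrow> f \<in> borel_measurable M \<and> sq_int M f < \<infinity>"
  by (auto simp: L2_space_def sq_int_def integrable_iff_bounded)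

text \<open>For square integrable functions the extended integral is finite and agrees with the
  Bochner integral, so the two measures of closeness coincide up to squaring.\<close>

lemma L2_norm_less_iff:
  assumes "f \<in> L2_space M" "\<epsilon> > 0"
  shows "L2_norm M f < \<epsilon> \<longleftrightarrow> sq_int M f < ennreal (\<epsilon>\<^sup>2)"
proof -
  have "sq_int M f = ennreal (\<integral>x. (norm (f x))\<^sup>2 \<partial>M)"
    using assms by (simp add: sq_int_def L2_space_def nn_integral_eq_integral)
  then have "sq_int M f < ennreal (\<epsilon>\<^sup>2) \<longleftrightarrow> (\<integral>x. (norm (f x))\<^sup>2 \<partial>M) < \<epsilon>\<^sup>2"
    by (simp add: ennreal_less_iff)
  also have "\<dots> \<longleftrightarrow> L2_norm M f < \<epsilon>"
    using assms(2) unfolding L2_norm_def by (metis real_less_rsqrt real_sqrt_less_iff real_sqrt_abs abs_of_pos)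
  finally show ?thesis ..
qed

lemma fun_subspace_L2_space: "fun_subspace M (L2_space M)"
proof
  fix v w :: "'a \<Rightarrow> complex" and c
  show "(\<lambda>x. v x + w x) \<in> L2_space M" if "v \<in> L2_space M" "w \<in> L2_space M"
  proof -
    have "sq_int M (\<lambda>x. v x + w x) \<le> 2 * sq_int M v + 2 * sq_int M w"
      using that by (intro sq_int_add_le) (auto simp: L2_space_iff)
    also have "\<dots> < \<infinity>"
      using that by (simp add: L2_space_iff ennreal_mult_less_top)
    finally show ?thesis using that by (auto simp: L2_space_iff)
  qed
  show "(\<lambda>x. c * w x) \<in> L2_space M" if "w \<in> L2_space M"
    using that by (auto simp: L2_space_iff sq_int_cmult ennreal_mult_less_top)
qed (auto simp: L2_space_iff sq_int_def)

lemma fun_span_subset_L2_space: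
  assumes "\<And>i. i \<in> I \<Longrightarrow> e i \<in> L2_space M"
  shows "fun_span I e \<subseteq> L2_space M"
proof -
  interpret fun_subspace M "L2_space M" by (rule fun_subspace_L2_space)
  have "(\<lambda>x. \<Sum>i\<in>J. c i * e i x) \<in> L2_space M" if "finite J" "J \<subseteq> I" for J and c :: "_ \<Rightarrow> complex"
    using that by (induction J) (auto intro!: W_zero W_add W_cmult assms)
  then show ?thesis by (auto simp: fun_span_def)
qed

text \<open>Turns the density clause of \<open>L2_orthogonal_basis\<close> into a statement about
  closures. Every difference \<open>f - w\<close> with \<open>w\<close> in the span is square
  integrable, so \<open>L2_norm_less_iff\<close> applies to it.\<close>

lemma L2_total_iff:
  assumes e: "\<And>i. i \<in> I \<Longrightarrow> e i \<in> L2_space M"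
  shows "(\<forall>f\<in>L2_space M. \<forall>\<epsilon>>0. \<exists>J c. finite J \<and> J \<subseteq> I \<and> L2_norm M (\<lambda>x. f x - (\<Sum>i\<in>J. c i * e i x)) < \<epsilon>)
     \<longleftrightarrow> L2_space M \<subseteq> L2_closure M (fun_span I e)"
proof -
  interpret fun_subspace M "L2_space M" by (rule fun_subspace_L2_space)
  have "(\<forall>\<epsilon>>0. \<exists>J c. finite J \<and> J \<subseteq> I \<and> L2_norm M (\<lambda>x. f x - (\<Sum>i\<in>J. c i * e i x)) < \<epsilon>) \<longleftrightarrow> f \<in> L2_closure M (fun_span I e)"
    if f: "f \<in> L2_space M" for f
  proof -
    have "f \<in> borel_measurable M" using f by (rule W_measurable)
    have diff: "(\<lambda>x. f x - w x) \<in> L2_space M" if "w \<in> fun_span I e" for w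
      using W_add[OF f W_cmult[of w "-1"]] that fun_span_subset_L2_space[of I e M] e by auto
    have *: "(\<exists>J c. finite J \<and> J \<subseteq> I \<and> L2_norm M (\<lambda>x. f x - (\<Sum>i\<in>J. c i * e i x)) < \<epsilon>)
        \<longleftrightarrow> (\<exists>w\<in>fun_span I e. sq_int M (\<lambda>x. f x - w x) < ennreal (\<epsilon>\<^sup>2))" (is "?L \<longleftrightarrow> ?R")
      if "\<epsilon> > 0" for \<epsilon>
    proof -
      have "?L \<longleftrightarrow> (\<exists>w\<in>fun_span I e. L2_norm M (\<lambda>x. f x - w x) < \<epsilon>)"
      proof
        assume ?L
        then obtain J c where J: "finite J" "J \<subseteq> I" "L2_norm M (\<lambda>x. f x - (\<Sum>i\<in>J. c i * e i x)) < \<epsilon>"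
          by blast
        then have "(\<lambda>x. \<Sum>i\<in>J. c i * e i x) \<in> fun_span I e"
          unfolding fun_span_def by blast
        with J show "\<exists>w\<in>fun_span I e. L2_norm M (\<lambda>x. f x - w x) < \<epsilon>"
          by (intro bexI[of _ "\<lambda>x. \<Sum>i\<in>J. c i * e i x"])
      next
        assume "\<exists>w\<in>fun_span I e. L2_norm M (\<lambda>x. f x - w x) < \<epsilon>"
        then show ?L unfolding fun_span_def by force
      qed
      also have "\<dots> \<longleftrightarrow> ?R"
        using L2_norm_less_iff[OF diff that] by blast
      finally show ?thesis .
    qed
    show ?thesis
    proof
      assume L: "\<forall>\<epsilon>>0. \<exists>J c. finite J \<and> J \<subseteq> I \<and> L2_norm M (\<lambda>x. f x - (\<Sum>i\<in>J. c i * e i x)) < \<epsilon>"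
      have "\<exists>w\<in>fun_span I e. sq_int M (\<lambda>x. f x - w x) < ennreal \<epsilon>" if "\<epsilon> > 0" for \<epsilon>
        using that L *[of "sqrt \<epsilon>"] by simp
      then show "f \<in> L2_closure M (fun_span I e)"
        unfolding L2_closure_def using \<open>f \<in> borel_measurable M\<close> by blast
    next
      assume "f \<in> L2_closure M (fun_span I e)"
      then have R: "\<exists>w\<in>fun_span I e. sq_int M (\<lambda>x. f x - w x) < ennreal \<epsilon>" if "\<epsilon> > 0" for \<epsilon>
        using that unfolding L2_closure_def by blast
      show "\<forall>\<epsilon>>0. \<exists>J c. finite J \<and> J \<subseteq> I \<and> L2_norm M (\<lambda>x. f x - (\<Sum>i\<in>J. c i * e i x)) < \<epsilon>"
      proof (intro allI impI)
        fix \<epsilon> :: real assume "\<epsilon> > 0"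
        then show "\<exists>J c. finite J \<and> J \<subseteq> I \<and> L2_norm M (\<lambda>x. f x - (\<Sum>i\<in>J. c i * e i x)) < \<epsilon>"
          unfolding *[OF \<open>\<epsilon> > 0\<close>] by (intro R) simp
      qed
    qed
  qed
  then show ?thesis by blast
qed

section \<open>Exponential bases and Borel representatives\<close>

text \<open>This lemma and the next one move integrals of Borel functions from \<Omega> with its
  Lebesgue sets to an almost everywhere equal Borel set and \<open>lborel\<close>.\<close>

lemma nn_integral_lebesgue_on_cong_borel:
  fixes f :: "'a::euclidean_space \<Rightarrow> ennreal"
  assumes "\<Omega> \<in> sets lebesgue" and [measurable]: "B \<in> sets borel" "f \<in> borel_measurable borel"
    and "AE x in lborel. x \<in> \<Omega> \<longleftrightarrow> x \<in> B"
  shows "(\<integral>\<^sup>+x. f x \<partial>lebesgue_on \<Omega>) = (\<integral>\<^sup>+x. f x \<partial>density lborel (indicator B))"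
proof -
  have "(\<integral>\<^sup>+x. f x \<partial>lebesgue_on \<Omega>) = (\<integral>\<^sup>+x. f x * indicator \<Omega> x \<partial>lborel)"
    using assms(1) by (simp add: nn_integral_restrict_space nn_integral_completion)
  also have "\<dots> = (\<integral>\<^sup>+x. indicator B x * f x \<partial>lborel)"
    using assms(4) by (intro nn_integral_cong_AE) (auto split: split_indicator)
  finally show ?thesis by (simp add: nn_integral_density)
qed

lemma integral_lebesgue_on_cong_borel:
  fixes f :: "'a::euclidean_space \<Rightarrow> 'b::{banach, second_countable_topology}"
  assumes \<Omega>: "\<Omega> \<in> sets lebesgue" and [measurable]: "B \<in> sets borel" "f \<in> borel_measurable borel"
    and ae: "AE x in lborel. x \<in> \<Omega> \<longleftrightarrow> x \<in> B"
  shows "integral\<^sup>L (lebesgue_on \<Omega>) f = (LINT x:B|lborel. f x)"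
proof -
  have "integral\<^sup>L (lebesgue_on \<Omega>) f = (\<integral>x. indicator \<Omega> x *\<^sub>R f x \<partial>lebesgue)"
    using \<Omega> by (simp add: integral_restrict_space)
  also have "\<dots> = (\<integral>x. indicator B x *\<^sub>R f x \<partial>lebesgue)"
  proof (rule integral_cong_AE)
    show "(\<lambda>x. indicator \<Omega> x *\<^sub>R f x) \<in> borel_measurable lebesgue"
      using \<Omega> by (intro borel_measurable_scaleR borel_measurable_indicator measurable_completion) auto
    show "(\<lambda>x. indicator B x *\<^sub>R f x) \<in> borel_measurable lebesgue"
      by (intro measurable_completion) measurable
    have "AE x in lebesgue. x \<in> \<Omega> \<longleftrightarrow> x \<in> B" using ae by (rule AE_completion)
    then show "AE x in lebesgue. indicator \<Omega> x *\<^sub>R f x = indicator B x *\<^sub>R f x"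
      by eventually_elim (auto split: split_indicator)
  qed
  also have "\<dots> = (LINT x:B|lborel. f x)"
    unfolding set_lebesgue_integral_def by (intro integral_completion) measurable
  finally show ?thesis .
qed

lemma AE_borel_representative:
  assumes "\<Omega> \<in> sets (lebesgue :: 'a::euclidean_space measure)"
  obtains B where "B \<in> sets borel" "AE x in lborel. x \<in> \<Omega> \<longleftrightarrow> x \<in> B"
proof
  show "main_part lborel \<Omega> \<in> sets borel" using main_part_sets[OF assms] by simp
  show "AE x in lborel. x \<in> \<Omega> \<longleftrightarrow> x \<in> main_part lborel \<Omega>"
    using AE_in_main_part[OF assms] by eventually_elim auto
qed

section \<open>Algebra of exponentials and the criterion for an exponential basis\<close>

lemma measurable_char_exp [measurable]: "char_exp l \<in> borel_measurable borel"
  unfolding char_exp_def[abs_def] by (intro borel_measurable_continuous_onI continuous_intros)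

lemma norm_char_exp [simp]: "norm (char_exp l x) = 1"
  unfolding char_exp_def using norm_exp_i_times[of "2 * pi * (l \<bullet> x)"] by (simp add: mult_ac)

lemma char_exp_diff: "char_exp (l - m) x = char_exp l x * cnj (char_exp m x)"
  unfolding char_exp_def
  by (simp add: exp_cnj inner_diff_left right_diff_distrib exp_diff exp_minus divide_inverse)

lemma char_exp_add_right: "char_exp l (x + y) = char_exp l x * char_exp l y"
  unfolding char_exp_def by (simp add: inner_add_right distrib_left exp_add)

lemma char_exp_Pair: "char_exp (l, m) (x, y) = char_exp l x * char_exp m y"
  unfolding char_exp_def by (simp add: inner_prod_def distrib_left exp_add)

lemma char_exp_zero [simp]: "char_exp 0 x = 1"
  unfolding char_exp_def by simp

text \<open>Restates spectrality in terms of \<open>B\<close> and \<open>lborel\<close> alone.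
  Exponentials have modulus 1, so they are square integrable and nonzero on \<Omega>; their inner
  products depend only on the difference of the frequencies; and for density it is enough to
  approximate indicators of Borel sets.\<close>

lemma char_exp_basis_iff:
  fixes \<Omega> :: "'a::euclidean_space set"
  assumes \<Omega>: "\<Omega> \<in> lmeasurable" "measure lebesgue \<Omega> > 0"
    and B[measurable]: "B \<in> sets borel" and ae: "AE x in lborel. x \<in> \<Omega> \<longleftrightarrow> x \<in> B"
  shows "L2_orthogonal_basis (lebesgue_on \<Omega>) \<Lambda> char_exp \<longleftrightarrow>
    pairwise (\<lambda>l m. (LINT x:B|lborel. char_exp (l - m) x) = 0) \<Lambda> \<and>
    (\<forall>E\<in>sets borel. indicator E \<in> L2_closure (density lborel (indicator B)) (fun_span \<Lambda> char_exp))"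
proof -
  let ?M = "lebesgue_on \<Omega>" and ?D = "density lborel (indicator B)"
  have \<Omega>': "\<Omega> \<in> sets lebesgue" using \<Omega> by auto
  have borelM: "f \<in> borel_measurable ?M" if "f \<in> borel_measurable borel" for f :: "'a \<Rightarrow> complex"
    using that by (intro measurable_restrict_space1 measurable_completion) simp
  interpret M: finite_measure ?M using \<Omega> by (intro finite_measure_lebesgue_on)
  have transfer: "sq_int ?M h = sq_int ?D h" if [measurable]: "h \<in> borel_measurable borel" for h
    unfolding sq_int_def by (rule nn_integral_lebesgue_on_cong_borel) (use \<Omega>' ae in auto)
  have char: "char_exp l \<in> L2_space ?M" for l
    by (simp add: L2_space_iff borelM sq_int_def less_top[symmetric])
  have "L2_norm ?M (char_exp l) \<noteq> 0" for l
    using \<Omega> by (simp add: L2_norm_def measure_restrict_space)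
  moreover have "L2_inner ?M (char_exp l) (char_exp m) = (LINT x:B|lborel. char_exp (l - m) x)" for l m
    unfolding L2_inner_def char_exp_diff[symmetric] using \<Omega>' ae
    by (intro integral_lebesgue_on_cong_borel) auto
  moreover have "L2_space ?M \<subseteq> L2_closure ?M (fun_span \<Lambda> char_exp) \<longleftrightarrow>
     (\<forall>E\<in>sets borel. indicator E \<in> L2_closure ?D (fun_span \<Lambda> char_exp))"
  proof -
    interpret S: fun_subspace ?M "fun_span \<Lambda> char_exp"
      by (intro fun_subspace_fun_span) (simp add: borelM)
    \<comment> \<open>Supplies Borel measurability of the members of the span, which
      \<open>transfer\<close> requires.\<close>
    interpret T: fun_subspace borel "fun_span \<Lambda> char_exp"
      by (intro fun_subspace_fun_span) simp
    have cl: "indicator E \<in> L2_closure ?M (fun_span \<Lambda> char_exp) \<longleftrightarrow>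
        indicator E \<in> L2_closure ?D (fun_span \<Lambda> char_exp)" if [measurable]: "E \<in> sets borel" for E
    proof -
      have "sq_int ?M (\<lambda>x. indicator E x - w x) = sq_int ?D (\<lambda>x. indicator E x - w x)"
        if "w \<in> fun_span \<Lambda> char_exp" for w
      proof -
        have [measurable]: "w \<in> borel_measurable borel" using that by (rule T.W_measurable)
        show ?thesis by (intro transfer) measurable
      qed
      moreover have "(indicator E :: 'a \<Rightarrow> complex) \<in> borel_measurable ?M" by (intro borelM) measurable
      moreover have "(indicator E :: 'a \<Rightarrow> complex) \<in> borel_measurable ?D" by measurable
      ultimately show ?thesis unfolding L2_closure_def by (simp cong: bex_cong)
    qed
    have "L2_space ?M \<subseteq> S.cl \<longleftrightarrow> (\<forall>E\<in>sets borel. indicator E \<in> S.cl)"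
    proof safe
      fix E :: "'a set" assume "E \<in> sets borel" and sub: "L2_space ?M \<subseteq> S.cl"
      then have [measurable]: "E \<in> sets borel" by simp
      have "sq_int ?M (indicator E) \<le> sq_int ?M (\<lambda>x. 1)"
        unfolding sq_int_def by (intro nn_integral_mono) (auto split: split_indicator)
      also have "\<dots> < \<infinity>" by (simp add: sq_int_def less_top[symmetric])
      finally have "indicator E \<in> L2_space ?M" by (simp add: L2_space_iff borelM)
      with sub show "indicator E \<in> S.cl" by blast
    next
      fix f assume E: "\<forall>E\<in>sets borel. indicator E \<in> S.cl" and f: "f \<in> L2_space ?M"
      show "f \<in> S.cl"
      proof (rule S.closure_L2[OF M.finite_measure_axioms _ f])
        \<comment> \<open>Only Borel indicators are known to be approximable, so the Lebesgue set
          \<open>A\<close> is exchanged for a Borel set \<open>A'\<close> that agrees with it almost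
          everywhere.\<close>
        fix A assume A: "A \<in> sets ?M"
        then have "A \<in> sets lebesgue" using \<Omega>' by (auto simp: sets_restrict_space_iff)
        then obtain A' where A': "A' \<in> sets borel" "AE x in lborel. x \<in> A \<longleftrightarrow> x \<in> A'"
          by (rule AE_borel_representative)
        have "AE x in lebesgue. x \<in> \<Omega> \<longrightarrow> (x \<in> A \<longleftrightarrow> x \<in> A')"
          using AE_completion[OF A'(2)] by eventually_elim blast
        then have "AE x in ?M. x \<in> A \<longleftrightarrow> x \<in> A'"
          using \<Omega>' by (simp add: AE_restrict_space_iff)
        then have *: "AE x in ?M. indicator A x = (indicator A' x :: complex)"
          by eventually_elim (simp add: indicator_def)
        have "(indicator A :: 'a \<Rightarrow> complex) \<in> borel_measurable ?M"
          using A by (rule borel_measurable_indicator)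
        from S.closure_cong_AE[OF _ this *] show "indicator A \<in> S.cl"
          using E A'(1) by blast
      qed
    qed
    with cl show ?thesis by blast
  qed
  ultimately show ?thesis
    unfolding L2_orthogonal_basis_def L2_total_iff[OF char] using char by simp
qed

lemma set_integrable_char_exp:
  assumes "S \<in> sets borel" "emeasure lborel S < \<infinity>"
  shows "set_integrable lborel S (char_exp (l :: 'a::euclidean_space))"
proof -
  have "integrable lborel (\<lambda>x. indicator S x *\<^sub>R (1::complex))"
    using assms by (intro integrable_real_indicator[THEN integrable_scaleR_left]) auto
  then show ?thesis
    unfolding set_integrable_def
    by (rule Bochner_Integration.integrable_bound) (use assms(1) in \<open>auto split: split_indicator\<close>)
qed

section \<open>Translations and products of Lebesgue measure\<close>

lemma lborel_translate: "distr lborel borel (\<lambda>x. x - v) = (lborel :: 'a::euclidean_space measure)"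
proof -
  have "(\<lambda>x. x - v) = (+) (- v)" by auto
  then show ?thesis using lborel_distr_plus[of "- v"] by simp
qed

lemma nn_integral_lborel_translate:
  fixes f :: "'a::euclidean_space \<Rightarrow> ennreal"
  assumes [measurable]: "f \<in> borel_measurable borel"
  shows "(\<integral>\<^sup>+x. f (x - v) \<partial>lborel) = (\<integral>\<^sup>+x. f x \<partial>lborel)"
  by (subst (2) lborel_translate[of v, symmetric]) (simp add: nn_integral_distr)

lemma integral_lborel_translate:
  fixes f :: "'a::euclidean_space \<Rightarrow> 'b::{banach, second_countable_topology}"
  assumes [measurable]: "f \<in> borel_measurable borel"
  shows "(\<integral>x. f (x - v) \<partial>lborel) = (\<integral>x. f x \<partial>lborel)"
  by (subst (2) lborel_translate[of v, symmetric]) (simp add: integral_distr)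

lemma AE_lborel_translate:
  assumes "AE x in lborel. P x"
  shows "AE x in lborel. P (x - v :: 'a::euclidean_space)"
proof -
  have "AE x in distr lborel borel (\<lambda>x. x - v). P x"
    unfolding lborel_translate by fact
  then show ?thesis by (rule AE_distrD[rotated]) simp
qed

text \<open>A null set times the whole space is null, because 0 times infinity is 0 in
  \<open>ennreal\<close>.\<close>

lemma AE_lborel_fst:
  assumes "AE x in lborel. P (x::'a::euclidean_space)"
  shows "AE z in lborel. P (fst (z :: 'a \<times> 'b::euclidean_space))"
proof -
  obtain N where N: "{x. \<not> P x} \<subseteq> N" "N \<in> null_sets lborel"
    using assms by (auto simp: eventually_ae_filter)
  then have "N \<times> (UNIV::'b set) \<in> null_sets (lborel \<Otimes>\<^sub>M lborel)"
    by (auto simp: null_sets_def lborel.emeasure_pair_measure_Times intro!: pair_measureI)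
  then show ?thesis
    unfolding lborel_prod using N by (intro AE_I') auto
qed

lemma AE_lborel_snd:
  assumes "AE y in lborel. P (y::'b::euclidean_space)"
  shows "AE z in lborel. P (snd (z :: 'a::euclidean_space \<times> 'b))"
proof -
  obtain N where N: "{x. \<not> P x} \<subseteq> N" "N \<in> null_sets lborel"
    using assms by (auto simp: eventually_ae_filter)
  then have "(UNIV::'a set) \<times> N \<in> null_sets (lborel \<Otimes>\<^sub>M lborel)"
    by (auto simp: null_sets_def lborel.emeasure_pair_measure_Times intro!: pair_measureI)
  then show ?thesis
    unfolding lborel_prod using N by (intro AE_I') auto
qed

lemma nn_integral_lborel_Times:
  fixes f :: "'a::euclidean_space \<Rightarrow> ennreal" and g :: "'b::euclidean_space \<Rightarrow> ennreal"
  assumes [measurable]: "f \<in> borel_measurable borel" "g \<in> borel_measurable borel"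
  shows "(\<integral>\<^sup>+z. f (fst z) * g (snd z) \<partial>lborel) = (\<integral>\<^sup>+x. f x \<partial>lborel) * (\<integral>\<^sup>+y. g y \<partial>lborel)"
proof -
  have "(\<integral>\<^sup>+z. f (fst z) * g (snd z) \<partial>lborel)
      = (\<integral>\<^sup>+z. f (fst z) * g (snd z) \<partial>(lborel \<Otimes>\<^sub>M lborel))"
    by (simp add: lborel_prod)
  also have "\<dots> = (\<integral>\<^sup>+x. (\<integral>\<^sup>+y. f x * g y \<partial>lborel) \<partial>lborel)"
    by (subst lborel.nn_integral_fst[symmetric]) auto
  also have "\<dots> = (\<integral>\<^sup>+x. f x \<partial>lborel) * (\<integral>\<^sup>+y. g y \<partial>lborel)"
    by (simp add: nn_integral_cmult nn_integral_multc)
  finally show ?thesis .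
qed

lemma
  fixes f :: "'a::euclidean_space \<Rightarrow> complex" and g :: "'b::euclidean_space \<Rightarrow> complex"
  assumes f: "integrable lborel f" and g: "integrable lborel g"
  shows integrable_lborel_Times: "integrable lborel (\<lambda>z. f (fst z) * g (snd z))"
    and integral_lborel_Times:
      "(\<integral>z. f (fst z) * g (snd z) \<partial>lborel) = (\<integral>x. f x \<partial>lborel) * (\<integral>y. g y \<partial>lborel)"
proof -
  have [measurable]: "f \<in> borel_measurable borel" "g \<in> borel_measurable borel"
    using f g by (auto dest: borel_measurable_integrable)
  have *: "integrable (lborel \<Otimes>\<^sub>M lborel) (\<lambda>z. f (fst z) * g (snd z))"
  proof (rule lborel_pair.Fubini_integrable)
    show "integrable lborel (\<lambda>x. \<integral>y. norm (f (fst (x, y)) * g (snd (x, y))) \<partial>lborel)"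
      using f by (simp add: norm_mult)
  qed (use f g in auto)
  then show "integrable lborel (\<lambda>z. f (fst z) * g (snd z))" by (simp add: lborel_prod)
  have "(\<integral>z. f (fst z) * g (snd z) \<partial>lborel) = (\<integral>z. f (fst z) * g (snd z) \<partial>(lborel \<Otimes>\<^sub>M lborel))"
    by (simp add: lborel_prod)
  also have "\<dots> = (\<integral>x. (\<integral>y. f x * g y \<partial>lborel) \<partial>lborel)"
    using lborel_pair.integral_fst'[OF *] by simp
  finally show "(\<integral>z. f (fst z) * g (snd z) \<partial>lborel) = (\<integral>x. f x \<partial>lborel) * (\<integral>y. g y \<partial>lborel)"
    by simp
qed

lemma measurable_product_function:
  fixes f :: "'a::second_countable_topology \<Rightarrow> complex" and g :: "'b::second_countable_topology \<Rightarrow> complex"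
  assumes [measurable]: "f \<in> borel_measurable borel" "g \<in> borel_measurable borel"
  shows "(\<lambda>z. f (fst z) * g (snd z)) \<in> borel_measurable borel"
  unfolding borel_prod[symmetric] by measurable

section \<open>The integer grid\<close>

definition floor_vec :: "real ^ 'k \<Rightarrow> int ^ 'k" where
  "floor_vec y = (\<chi> i. \<lfloor>y $ i\<rfloor>)"

text \<open>The half-open unit cube with lower corner \<open>z\<close>. Unlike the closed cubes,
  these partition the space exactly.\<close>

definition cell :: "int ^ 'k \<Rightarrow> (real ^ 'k) set" where
  "cell z = {y. floor_vec y = z}"

lemma floor_vec_diff_real_vec: "floor_vec (y - real_vec z) = floor_vec y - z"
  by (simp add: floor_vec_def real_vec_def vec_eq_iff)

lemma cell_borel [measurable]: "cell z \<in> sets borel"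
proof -
  have "cell z = (\<Inter>i. {y. real_of_int (z $ i) \<le> y $ i} \<inter> {y. y $ i < real_of_int (z $ i) + 1})"
    by (auto simp: cell_def floor_vec_def vec_eq_iff floor_eq_iff)
  also have "\<dots> \<in> sets borel"
    by (intro sets.countable_INT'' sets.Int borel_closed borel_open closed_Collect_le
        open_Collect_less continuous_intros) auto
  finally show ?thesis .
qed

text \<open>Excludes the boundaries of all integer unit cubes, the only points where closed cubes
  and half-open cells disagree.\<close>

definition off_grid :: "real ^ 'k \<Rightarrow> bool" where
  "off_grid y \<longleftrightarrow> (\<forall>i. y $ i \<notin> \<int>)"

text \<open>The exceptional set is a countable union of hyperplanes on which one coordinate is a
  fixed integer.\<close>

lemma AE_off_grid: "AE y in lborel. off_grid y"
proof -
  have "AE y in lborel. (y :: real ^ 'k) $ i \<noteq> of_int m" for i m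
  proof -
    have "axis i (1::real) \<in> Basis" by (auto simp: Basis_vec_def)
    then have "{y :: real ^ 'k. y $ i = of_int m} \<in> null_sets lebesgue"
      using negligible_standard_hyperplane[of "axis i (1::real)" "of_int m"]
      by (simp add: negligible_iff_null_sets inner_axis)
    then have "AE y in lebesgue. (y :: real ^ 'k) $ i \<noteq> of_int m"
      by (auto dest: AE_not_in)
    then show ?thesis by (simp add: AE_completion_iff)
  qed
  then have "AE y in lborel. \<forall>i m. (y :: real ^ 'k) $ i \<noteq> of_int m"
    unfolding AE_all_countable by blast
  then show ?thesis
    by eventually_elim (auto simp: off_grid_def Ints_def)
qed

lemma off_grid_mem_cube_iff:
  assumes "off_grid y"
  shows "y - real_vec z \<in> cbox 0 1 \<longleftrightarrow> floor_vec y = z"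
proof -
  have "real_of_int (z $ i) \<le> y $ i \<and> y $ i \<le> real_of_int (z $ i) + 1 \<longleftrightarrow> \<lfloor>y $ i\<rfloor> = z $ i" for i
  proof -
    \<comment> \<open>Closed and half-open intervals differ only in the upper endpoint, which
      \<open>off_grid\<close> rules out.\<close>
    have "y $ i \<noteq> real_of_int (z $ i + 1)"
      using assms unfolding off_grid_def by (metis Ints_of_int)
    then show ?thesis by (auto simp: floor_eq_iff)
  qed
  then show ?thesis
    by (auto simp: mem_box_cart real_vec_def floor_vec_def vec_eq_iff algebra_simps)
qed

lemma off_grid_diff_real_vec: "off_grid (y - real_vec z) \<longleftrightarrow> off_grid y"
proof -
  have "y $ i - real_of_int (z $ i) \<in> \<int> \<longleftrightarrow> y $ i \<in> \<int>" for i
    by (metis Ints_add Ints_diff Ints_of_int diff_add_cancel)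
  then show ?thesis by (simp add: off_grid_def real_vec_def)
qed

lemma emeasure_cell: "emeasure lborel (cell z) = 1"
proof -
  have "emeasure lborel (cell z) = emeasure lborel (cbox (real_vec z) (real_vec z + 1))"
  proof (rule emeasure_eq_AE)
    show "AE y in lborel. y \<in> cell z \<longleftrightarrow> y \<in> cbox (real_vec z) (real_vec z + 1)"
      using AE_off_grid
    proof eventually_elim
      case (elim y)
      have "y \<in> cbox (real_vec z) (real_vec z + 1) \<longleftrightarrow> y - real_vec z \<in> cbox 0 1"
        by (auto simp: mem_box_cart algebra_simps)
      with off_grid_mem_cube_iff[OF elim] show ?case by (simp add: cell_def)
    qed
  qed auto
  also have "\<dots> = ennreal (measure lborel (cbox (real_vec z) (real_vec z + 1)))"
    by (intro emeasure_eq_ennreal_measure) (simp add: emeasure_lborel_cbox_eq)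
  also have "measure lborel (cbox (real_vec z) (real_vec z + 1)) = 1"
    by (subst content_cbox_cart) (auto simp: interval_ne_empty_cart)
  finally show ?thesis by simp
qed

lemma mem_translate_iff: "x \<in> (+) a ` S \<longleftrightarrow> x - a \<in> S" for a x :: "'a::ab_group_add"
  by (metis add.commute add_diff_cancel_right' diff_add_cancel image_iff)

section \<open>Stacked sets\<close>

text \<open>
  The Borel set \<open>B\<close> stands in for \<open>\<Omega>\<close> because Fubini and the product \<open>\<sigma>\<close>-algebra are available for
  \<^const>\<open>lborel\<close>, but not for its completion.
\<close>

locale stacked_set =
  fixes \<Omega> B :: "(real ^ 'd) set" and n :: nat
    and v :: "nat \<Rightarrow> real ^ 'd" and s :: "nat \<Rightarrow> int ^ 'k"
  assumes lmeasurable: "\<Omega> \<in> lmeasurable" and inj: "inj_on s {..<n}"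
    and B_borel [measurable]: "B \<in> sets borel"
    and AE_B: "AE x in lborel. x \<in> \<Omega> \<longleftrightarrow> x \<in> B"
begin

section \<open>The stack, its Borel version, and integration over it\<close>

definition stack :: "((real ^ 'd) \<times> (real ^ 'k)) set" where
  "stack = (\<Omega> \<times> cbox 0 1) + (\<lambda>j. (v j, real_vec (s j))) ` {..<n}"

text \<open>Besides \<Omega>, the closed cubes are replaced too: with half-open cells the pieces are
  truly disjoint, so indicators split into exact sums. \<open>cells\<close> is related to
  \<open>cubes\<close> in the same way.\<close>

definition borel_stack :: "((real ^ 'd) \<times> (real ^ 'k)) set" where
  "borel_stack = {(x, y). \<exists>j<n. x - v j \<in> B \<and> y \<in> cell (s j)}"

definition cubes :: "(real ^ 'k) set" where
  "cubes = real_vec ` s ` {..<n} + cbox 0 1"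

definition cells :: "(real ^ 'k) set" where
  "cells = (\<Union>j<n. cell (s j))"

lemma mem_stack_iff:
  "(x, y) \<in> stack \<longleftrightarrow> (\<exists>j<n. x - v j \<in> \<Omega> \<and> y - real_vec (s j) \<in> cbox 0 1)"
proof
  assume "(x, y) \<in> stack"
  then show "\<exists>j<n. x - v j \<in> \<Omega> \<and> y - real_vec (s j) \<in> cbox 0 1"
    by (auto simp: stack_def set_plus_def)
next
  assume "\<exists>j<n. x - v j \<in> \<Omega> \<and> y - real_vec (s j) \<in> cbox 0 1"
  then obtain j where j: "j < n" "x - v j \<in> \<Omega>" "y - real_vec (s j) \<in> cbox 0 1" by blast
  have "(x - v j, y - real_vec (s j)) + (v j, real_vec (s j)) \<in> stack"
    unfolding stack_def using j by (intro set_plus_intro) auto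
  then show "(x, y) \<in> stack" by simp
qed

lemma off_grid_mem_stack_iff:
  "off_grid y \<Longrightarrow> (x, y) \<in> stack \<longleftrightarrow> (\<exists>j<n. x - v j \<in> \<Omega> \<and> floor_vec y = s j)"
  by (simp add: mem_stack_iff off_grid_mem_cube_iff)

text \<open>Two kinds of points are discarded: those where some \<open>x - v j\<close> distinguishes
  \<Omega> from \<open>B\<close>, a finite union of null sets, and those with \<open>y\<close> on
  the grid.\<close>

lemma AE_stack: "AE z in lborel. z \<in> stack \<longleftrightarrow> z \<in> borel_stack"
proof -
  have "AE x in lborel. \<forall>j\<in>{..<n}. x - v j \<in> \<Omega> \<longleftrightarrow> x - v j \<in> B"
    using AE_lborel_translate[OF AE_B] by (simp add: AE_ball_countable)
  from AE_lborel_fst[OF this] AE_lborel_snd[OF AE_off_grid] show ?thesis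
  proof eventually_elim
    case (elim z)
    then show ?case
      by (cases z) (auto simp: borel_stack_def cell_def off_grid_mem_stack_iff)
  qed
qed

lemma AE_cubes: "AE y in lborel. y \<in> cubes \<longleftrightarrow> y \<in> cells"
  using AE_off_grid
proof eventually_elim
  case (elim y)
  have "y \<in> cubes \<longleftrightarrow> (\<exists>j<n. y - real_vec (s j) \<in> cbox 0 1)"
  proof
    assume "\<exists>j<n. y - real_vec (s j) \<in> cbox 0 1"
    then obtain j where "j < n" "y - real_vec (s j) \<in> cbox 0 1" by blast
    then have "real_vec (s j) + (y - real_vec (s j)) \<in> cubes"
      unfolding cubes_def by (intro set_plus_intro) auto
    then show "y \<in> cubes" by simp
  qed (auto simp: cubes_def set_plus_def)
  with elim show ?case by (auto simp: cells_def cell_def off_grid_mem_cube_iff)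
qed

lemma cells_borel [measurable]: "cells \<in> sets borel"
  unfolding cells_def by measurable

lemma indicator_cells: "indicator cells y = (\<Sum>j<n. indicator (cell (s j)) y)"
  unfolding cells_def using inj
  by (intro indicator_UN_disjoint) (auto simp: disjoint_family_on_def cell_def inj_on_def)

lemma borel_stack_eq: "borel_stack = (\<Union>j<n. ((\<lambda>x. x - v j) -` B) \<times> cell (s j))"
  by (auto simp: borel_stack_def)

lemma borel_stack_borel [measurable]: "borel_stack \<in> sets borel"
proof -
  have [measurable]: "(\<lambda>x. x - v j) -` B \<in> sets borel" for j
    using measurable_sets[of "\<lambda>x. x - v j" borel borel B] by simp
  show ?thesis
    unfolding borel_stack_eq borel_prod[symmetric] by measurable
qed

text \<open>Pieces with different indices lie over different cells because \<open>s\<close> is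
  injective. Hence they are disjoint even where the translates of \<open>B\<close> by the
  \<open>v j\<close> overlap.\<close>

lemma indicator_borel_stack:
  "indicator borel_stack (x, y) = (\<Sum>j<n. indicator B (x - v j) * indicator (cell (s j)) y :: 'a :: comm_semiring_1)"
proof -
  have "indicator borel_stack (x, y) = (\<Sum>j<n. indicator (((\<lambda>x. x - v j) -` B) \<times> cell (s j)) (x, y) :: 'a)"
    unfolding borel_stack_eq using inj
    by (intro indicator_UN_disjoint) (auto simp: disjoint_family_on_def cell_def inj_on_def)
  also have "\<dots> = (\<Sum>j<n. indicator B (x - v j) * indicator (cell (s j)) y)"
    by (intro sum.cong refl) (auto simp: indicator_def)
  finally show ?thesis .
qed

text \<open>Tonelli on each piece; translation invariance then moves the shift by \<open>v j\<close>
  from \<open>B\<close> to the integrand, so that every summand is an integral over the same set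
  \<open>B\<close>.\<close>

lemma nn_integral_borel_stack:
  assumes [measurable]: "f \<in> borel_measurable borel" "g \<in> borel_measurable borel"
  shows "(\<integral>\<^sup>+z. indicator borel_stack z * (f (fst z) * g (snd z)) \<partial>lborel)
    = (\<Sum>j<n. (\<integral>\<^sup>+x. indicator B x * f (x + v j) \<partial>lborel) * (\<integral>\<^sup>+y. indicator (cell (s j)) y * g y \<partial>lborel))"
proof -
  have "(\<integral>\<^sup>+z. indicator borel_stack z * (f (fst z) * g (snd z)) \<partial>lborel)
    = (\<integral>\<^sup>+z. (\<Sum>j<n. (indicator B (fst z - v j) * f (fst z)) * (indicator (cell (s j)) (snd z) * g (snd z))) \<partial>lborel)"
  proof (intro nn_integral_cong)
    fix z :: "(real ^ 'd) \<times> (real ^ 'k)"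
    show "indicator borel_stack z * (f (fst z) * g (snd z)) =
      (\<Sum>j<n. (indicator B (fst z - v j) * f (fst z)) * (indicator (cell (s j)) (snd z) * g (snd z)))"
      using indicator_borel_stack[of "fst z" "snd z", where 'a = ennreal]
      by (simp only: prod.collapse sum_distrib_right sum_distrib_left mult_ac)
  qed
  also have "\<dots> = (\<Sum>j<n. \<integral>\<^sup>+z. (indicator B (fst z - v j) * f (fst z)) * (indicator (cell (s j)) (snd z) * g (snd z)) \<partial>lborel)"
    unfolding lborel_prod[symmetric] by (intro nn_integral_sum) measurable
  also have "\<dots> = (\<Sum>j<n. (\<integral>\<^sup>+x. indicator B x * f (x + v j) \<partial>lborel) * (\<integral>\<^sup>+y. indicator (cell (s j)) y * g y \<partial>lborel))"
  proof (intro sum.cong refl)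
    fix j
    have "(\<integral>\<^sup>+x. indicator B (x - v j) * f x \<partial>lborel) = (\<integral>\<^sup>+x. indicator B x * f (x + v j) \<partial>lborel)"
      using nn_integral_lborel_translate[of "\<lambda>x. indicator B x * f (x + v j)" "v j"] by simp
    then show "(\<integral>\<^sup>+z. (indicator B (fst z - v j) * f (fst z)) * (indicator (cell (s j)) (snd z) * g (snd z)) \<partial>lborel)
      = (\<integral>\<^sup>+x. indicator B x * f (x + v j) \<partial>lborel) * (\<integral>\<^sup>+y. indicator (cell (s j)) y * g y \<partial>lborel)"
      by (subst nn_integral_lborel_Times[of "\<lambda>x. indicator B (x - v j) * f x" "\<lambda>y. indicator (cell (s j)) y * g y"]) auto
  qed
  finally show ?thesis .
qed

lemma emeasure_B: "emeasure lborel B = ennreal (measure lebesgue \<Omega>)"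
proof -
  have "AE x in lebesgue. x \<in> \<Omega> \<longleftrightarrow> x \<in> B" using AE_B by (rule AE_completion)
  then have "emeasure lebesgue \<Omega> = emeasure lebesgue B"
    using lmeasurable by (intro emeasure_eq_AE) auto
  moreover have "emeasure lebesgue B = emeasure lborel B"
    by simp
  ultimately show ?thesis using lmeasurable by (simp add: emeasure_eq_measure2)
qed

lemma emeasure_borel_stack: "emeasure lborel borel_stack = ennreal (n * measure lebesgue \<Omega>)"
  using nn_integral_borel_stack[of "\<lambda>_. 1" "\<lambda>_. 1"]
  by (simp add: emeasure_B emeasure_cell ennreal_of_nat_eq_real_of_nat ennreal_mult)

lemma lmeasurable_stack: "stack \<in> lmeasurable"
  and measure_stack: "measure lebesgue stack = n * measure lebesgue \<Omega>"
proof -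
  have ae: "AE z in lebesgue. z \<in> borel_stack \<longleftrightarrow> z \<in> stack"
    using AE_completion[OF AE_stack] by eventually_elim auto
  then have "stack \<in> sets lebesgue"
    by (rule completion.in_sets_AE) auto
  moreover from this have "emeasure lebesgue stack = emeasure lebesgue borel_stack"
    using ae by (intro emeasure_eq_AE) auto
  then have *: "emeasure lebesgue stack = ennreal (n * measure lebesgue \<Omega>)"
    by (simp add: emeasure_borel_stack)
  ultimately show "stack \<in> lmeasurable" by (intro fmeasurableI) auto
  show "measure lebesgue stack = n * measure lebesgue \<Omega>"
    using * by (simp add: measure_def)
qed

section \<open>Tiling\<close>

text \<open>Off the grid, the lattice tiling applied to \<open>floor_vec y\<close> selects
  \<open>t\<close> and \<open>j\<close>, and the tiling by \<Omega> applied to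
  \<open>x - v j\<close> then selects \<open>a\<close>.\<close>

lemma tiles_space_stack:
  assumes "tiles_lattice (s ` {..<n})" "tiles_space \<Omega>"
  shows "tiles_space stack"
proof -
  obtain T where disj: "disjoint_family_on (\<lambda>t. (+) t ` s ` {..<n}) T"
    and UN: "(\<Union>t\<in>T. (+) t ` s ` {..<n}) = UNIV"
    using assms(1) by (auto simp: tiles_lattice_def)
  obtain A where A: "countable A" "AE x in lebesgue. \<exists>!a. a \<in> A \<and> x \<in> (+) a ` \<Omega>"
    and pos: "measure lebesgue \<Omega> > 0"
    using assms(2) by (auto simp: tiles_space_def)
  \<comment> \<open>An empty set has no translates covering the lattice. Positivity of
    \<open>n\<close> is what gives the stack positive measure.\<close>
  have "n > 0"
    using UN by (cases n) auto
  define C where "C = (\<lambda>(a, t). (a, real_vec t)) ` (A \<times> T)"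
  have "countable C"
    unfolding C_def using A(1) by (intro countable_image countable_SIGMA) auto
  have "AE x in lborel. \<exists>!a. a \<in> A \<and> x - a \<in> \<Omega>"
    using A(2) by (simp add: AE_completion_iff mem_translate_iff)
  \<comment> \<open>All shifts are treated at once, since the relevant \<open>j\<close> depends on
    \<open>y\<close>.\<close>
  then have "AE x in lborel. \<forall>j\<in>{..<n}. \<exists>!a. a \<in> A \<and> x - v j - a \<in> \<Omega>"
    by (simp add: AE_ball_countable AE_lborel_translate[where P = "\<lambda>x. \<exists>!a. a \<in> A \<and> x - a \<in> \<Omega>"])
  from AE_lborel_fst[OF this] AE_lborel_snd[OF AE_off_grid]
  have "AE z in lborel. \<exists>!c. c \<in> C \<and> z - c \<in> stack"
  proof eventually_elim
    case (elim z)
    obtain x y where z: "z = (x, y)" by (cases z)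
    have "floor_vec y \<in> (\<Union>t\<in>T. (+) t ` s ` {..<n})" using UN by simp
    then obtain t j where tj: "t \<in> T" "j < n" "floor_vec y = t + s j" by auto
    obtain a where a: "a \<in> A" "x - v j - a \<in> \<Omega>"
      and a_unique: "\<And>a'. a' \<in> A \<Longrightarrow> x - v j - a' \<in> \<Omega> \<Longrightarrow> a' = a"
      using elim(1) tj(2) z by fastforce
    have mem: "z - (a', real_vec t') \<in> stack \<longleftrightarrow> (\<exists>i<n. x - v i - a' \<in> \<Omega> \<and> floor_vec y = t' + s i)" for a' t'
      using elim(2) z
      by (auto simp: off_grid_mem_stack_iff off_grid_diff_real_vec floor_vec_diff_real_vec algebra_simps)
    show ?case
    proof (intro ex1I conjI)
      show "(a, real_vec t) \<in> C" using a tj by (auto simp: C_def)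
      show "z - (a, real_vec t) \<in> stack" using mem a tj by blast
      fix c assume "c \<in> C \<and> z - c \<in> stack"
      then obtain a' t' i where c: "c = (a', real_vec t')" "a' \<in> A" "t' \<in> T" and
        i: "i < n" "x - v i - a' \<in> \<Omega>" "floor_vec y = t' + s i"
        using mem by (auto simp: C_def)
      have "floor_vec y \<in> (+) t ` s ` {..<n}"
        unfolding tj(3) using tj(2) by simp
      moreover have "floor_vec y \<in> (+) t' ` s ` {..<n}"
        unfolding i(3) using i(1) by simp
      ultimately have "t' = t"
        using disj tj(1) c(3) unfolding disjoint_family_on_def by blast
      with tj i have "s i = s j" by simp
      with inj i tj have "i = j" by (auto dest: inj_onD)
      with i c a_unique \<open>t' = t\<close> show "c = (a, real_vec t)" by auto
    qed
  qed
  then have "AE z in lebesgue. \<exists>!c. c \<in> C \<and> z \<in> (+) c ` stack"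
    by (simp add: AE_completion_iff mem_translate_iff)
  moreover have "measure lebesgue stack > 0"
    using \<open>n > 0\<close> pos by (simp add: measure_stack)
  ultimately show ?thesis
    using lmeasurable_stack \<open>countable C\<close> by (auto simp: tiles_space_def)
qed

text \<open>A single well-chosen height suffices: the slice of the tiling there is a tiling by
  translates of \<Omega>.\<close>

lemma tiles_space_base:
  assumes "tiles_space stack"
  shows "tiles_space \<Omega>"
proof -
  obtain A where A: "countable A" "AE z in lebesgue. \<exists>!a. a \<in> A \<and> z \<in> (+) a ` stack"
    using assms by (auto simp: tiles_space_def)
  have "measure lebesgue stack > 0" using assms by (simp add: tiles_space_def)
  then have pos: "measure lebesgue \<Omega> > 0"
    by (simp add: measure_stack zero_less_mult_iff)
  have "AE z in lborel \<Otimes>\<^sub>M lborel. \<exists>!a. a \<in> A \<and> z - a \<in> stack"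
    unfolding lborel_prod using A(2) by (simp add: AE_completion_iff mem_translate_iff)
  \<comment> \<open>The coordinates are swapped because \<open>AE_pair\<close> fixes the first one,
    and slices at fixed \<open>y\<close> are wanted.\<close>
  then have "AE w in lborel \<Otimes>\<^sub>M lborel. \<exists>!a. a \<in> A \<and> (case w of (y, x) \<Rightarrow> (x, y)) - a \<in> stack"
    by (subst (asm) lborel_pair.distr_pair_swap) (rule AE_distrD[rotated], auto)
  then have "AE y in lborel. AE x in lborel. \<exists>!a. a \<in> A \<and> (x, y) - a \<in> stack"
    by (auto dest: lborel_pair.AE_pair)
  \<comment> \<open>Countability of \<open>A\<close> keeps the union of the exceptional heights
    null.\<close>
  moreover have "AE y in lborel. \<forall>a\<in>A. off_grid (y - snd a)"
    using A(1) by (simp add: AE_ball_countable AE_lborel_translate[OF AE_off_grid])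
  ultimately have "AE y in lborel. (AE x in lborel. \<exists>!a. a \<in> A \<and> (x, y) - a \<in> stack)
      \<and> (\<forall>a\<in>A. off_grid (y - snd a))"
    by eventually_elim blast
  \<comment> \<open>The whole space is not null, so a property that holds almost everywhere holds at
    some height.\<close>
  moreover have "ae_filter (lborel :: (real ^ 'k) measure) \<noteq> bot"
    by (simp add: ae_filter_eq_bot_iff emeasure_lborel_UNIV)
  ultimately obtain y where y: "AE x in lborel. \<exists>!a. a \<in> A \<and> (x, y) - a \<in> stack"
    "\<And>a. a \<in> A \<Longrightarrow> off_grid (y - snd a)"
    by (metis (mono_tags, lifting) eventually_happens')
  \<comment> \<open>The translate of the stack by \<open>a\<close> meets height \<open>y\<close> in
    \<Omega> shifted by \<open>fst a + v j\<close> if \<open>y - snd a\<close> lies in the cell of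
    \<open>s j\<close>, and not at all if it lies in no such cell.\<close>
  define C where "C = {fst a + v j | a j. a \<in> A \<and> j < n \<and> floor_vec (y - snd a) = s j}"
  have "C \<subseteq> (\<lambda>(a, j). fst a + v j) ` (A \<times> {..<n})"
    by (force simp: C_def)
  then have "countable C"
    by (rule countable_subset) (intro countable_image countable_SIGMA A(1), auto)
  have "AE x in lborel. \<exists>!c. c \<in> C \<and> x - c \<in> \<Omega>"
    using y(1)
  proof eventually_elim
    case (elim x)
    have mem: "(x, y) - a \<in> stack \<longleftrightarrow> (\<exists>j<n. x - (fst a + v j) \<in> \<Omega> \<and> floor_vec (y - snd a) = s j)"
      if "a \<in> A" for a
      using off_grid_mem_stack_iff[OF y(2)[OF that], of "x - fst a"]
      by (cases a) (simp add: diff_diff_add)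
    obtain a where a: "a \<in> A" "(x, y) - a \<in> stack"
      and a_unique: "\<And>a'. a' \<in> A \<Longrightarrow> (x, y) - a' \<in> stack \<Longrightarrow> a' = a"
      using elim by blast
    then obtain j where j: "j < n" "x - (fst a + v j) \<in> \<Omega>" "floor_vec (y - snd a) = s j"
      using mem by blast
    show ?case
    proof (intro ex1I conjI)
      show "fst a + v j \<in> C" unfolding C_def using a j by blast
      show "x - (fst a + v j) \<in> \<Omega>" by fact
      fix c assume "c \<in> C \<and> x - c \<in> \<Omega>"
      then obtain a' i where c: "c = fst a' + v i" "a' \<in> A" "i < n" "floor_vec (y - snd a') = s i"
        "x - (fst a' + v i) \<in> \<Omega>"
        by (auto simp: C_def)
      with a_unique mem have "a' = a" by blast
      with c j have "s i = s j" by simp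
      with inj c j have "i = j" by (auto dest: inj_onD)
      with c \<open>a' = a\<close> show "c = fst a + v j" by simp
    qed
  qed
  then have "AE x in lebesgue. \<exists>!c. c \<in> C \<and> x \<in> (+) c ` \<Omega>"
    by (simp add: AE_completion_iff mem_translate_iff)
  with pos \<open>countable C\<close> lmeasurable show ?thesis
    by (auto simp: tiles_space_def)
qed

section \<open>Spectrality\<close>

lemma emeasure_B_finite: "emeasure lborel B < \<infinity>"
  by (simp add: emeasure_B)

section \<open>Orthogonality of the product exponentials\<close>

lemma set_integral_char_exp_cells:
  "(LINT y:cells|lborel. char_exp m y) = (\<Sum>j<n. LINT y:cell (s j)|lborel. char_exp m y)"
proof -
  have "(LINT y:cells|lborel. char_exp m y) = (\<integral>y. (\<Sum>j<n. indicator (cell (s j)) y *\<^sub>R char_exp m y) \<partial>lborel)"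
    by (simp only: set_lebesgue_integral_def indicator_cells scaleR_sum_left)
  also have "\<dots> = (\<Sum>j<n. LINT y:cell (s j)|lborel. char_exp m y)"
    unfolding set_lebesgue_integral_def
    using set_integrable_char_exp[OF cell_borel] unfolding set_integrable_def
    by (intro Bochner_Integration.integral_sum) (simp add: emeasure_cell)
  finally show ?thesis .
qed

text \<open>Each piece factors by Fubini, and shifting by \<open>v j\<close> contributes the phase
  \<open>char_exp l (v j)\<close>. The integral over \<open>B\<close> is common to all pieces, so
  its vanishing alone makes the whole integral vanish.\<close>

lemma set_integral_char_exp_borel_stack:
  "(LINT z:borel_stack|lborel. char_exp (l, m) z)
    = (\<Sum>j<n. char_exp l (v j) * (LINT y:cell (s j)|lborel. char_exp m y)) * (LINT x:B|lborel. char_exp l x)"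
proof -
  define f where "f = (\<lambda>j x. indicator B (x - v j) *\<^sub>R char_exp l x)"
  define g where "g = (\<lambda>j y. indicator (cell (s j)) y *\<^sub>R char_exp m y)"
  have g: "integrable lborel (g j)" for j
    using set_integrable_char_exp[OF cell_borel, of "s j" m]
    by (simp add: g_def set_integrable_def emeasure_cell)
  have f: "integrable lborel (f j)" for j
  proof -
    have "f j = (\<lambda>x. indicator ((\<lambda>x. x - v j) -` B) x *\<^sub>R char_exp l x)"
      by (auto simp: f_def indicator_def)
    moreover have "emeasure lborel ((\<lambda>x. x - v j) -` B) = emeasure lborel B"
      using nn_integral_lborel_translate[of "indicator B" "v j"]
      by (subst lborel_translate[of "v j", symmetric]) (simp add: emeasure_distr)
    moreover have "(\<lambda>x. x - v j) -` B \<in> sets borel"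
      using measurable_sets[of "\<lambda>x. x - v j" borel borel B] by simp
    ultimately show ?thesis
      using set_integrable_char_exp[of "(\<lambda>x. x - v j) -` B" l] emeasure_B_finite
      by (simp add: set_integrable_def)
  qed
  have int_f: "integral\<^sup>L lborel (f j) = char_exp l (v j) * (LINT x:B|lborel. char_exp l x)" for j
  proof -
    have "integral\<^sup>L lborel (f j) = (\<integral>x. indicator B (x - v j) *\<^sub>R char_exp l ((x - v j) + v j) \<partial>lborel)"
      by (simp add: f_def)
    also have "\<dots> = (\<integral>x. indicator B x *\<^sub>R char_exp l (x + v j) \<partial>lborel)"
      by (rule integral_lborel_translate[of "\<lambda>x. indicator B x *\<^sub>R char_exp l (x + v j)"]) measurable
    also have "\<dots> = (\<integral>x. char_exp l (v j) * (indicator B x *\<^sub>R char_exp l x) \<partial>lborel)"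
      by (simp add: char_exp_add_right mult.commute)
    finally show ?thesis unfolding set_lebesgue_integral_def integral_mult_right_zero .
  qed
  have "indicator borel_stack z *\<^sub>R char_exp (l, m) z = (\<Sum>j<n. f j (fst z) * g j (snd z))" for z
  proof -
    have "indicator borel_stack z *\<^sub>R char_exp (l, m) z
        = indicator borel_stack z *\<^sub>R (char_exp l (fst z) * char_exp m (snd z))"
      using char_exp_Pair[of l m "fst z" "snd z"] by simp
    also have "\<dots> = (\<Sum>j<n. (indicator B (fst z - v j) * indicator (cell (s j)) (snd z)) *\<^sub>R
        (char_exp l (fst z) * char_exp m (snd z)))"
      using indicator_borel_stack[of "fst z" "snd z", where 'a = real]
      by (simp only: prod.collapse scaleR_sum_left)
    also have "\<dots> = (\<Sum>j<n. f j (fst z) * g j (snd z))"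
      unfolding f_def g_def by (intro sum.cong refl) (simp split: split_indicator)
    finally show ?thesis .
  qed
  then have "(LINT z:borel_stack|lborel. char_exp (l, m) z) = (\<integral>z. (\<Sum>j<n. f j (fst z) * g j (snd z)) \<partial>lborel)"
    by (simp add: set_lebesgue_integral_def)
  also have "\<dots> = (\<Sum>j<n. integral\<^sup>L lborel (f j) * integral\<^sup>L lborel (g j))"
    using f g by (simp add: Bochner_Integration.integral_sum integrable_lborel_Times integral_lborel_Times)
  also have "\<dots> = (\<Sum>j<n. char_exp l (v j) * (LINT y:cell (s j)|lborel. char_exp m y)) * (LINT x:B|lborel. char_exp l x)"
    unfolding int_f by (simp add: g_def set_lebesgue_integral_def sum_distrib_left mult_ac)
  finally show ?thesis .
qed

lemma pairwise_orthogonal_borel_stack: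
  assumes 1: "pairwise (\<lambda>l m. (LINT x:B|lborel. char_exp (l - m) x) = 0) \<Lambda>"
    and 2: "pairwise (\<lambda>l m. (LINT y:cells|lborel. char_exp (l - m) y) = 0) \<Gamma>"
  shows "pairwise (\<lambda>l m. (LINT z:borel_stack|lborel. char_exp (l - m) z) = 0) (\<Lambda> \<times> \<Gamma>)"
proof (rule pairwiseI)
  fix p q assume pq: "p \<in> \<Lambda> \<times> \<Gamma>" "q \<in> \<Lambda> \<times> \<Gamma>" "p \<noteq> q"
  obtain a b c d where p: "p = (a, b)" and q: "q = (c, d)" by (cases p, cases q)
  show "(LINT z:borel_stack|lborel. char_exp (p - q) z) = 0"
  proof (cases "a = c")
    case False
    with pq 1 show ?thesis
      by (simp add: p q set_integral_char_exp_borel_stack pairwise_def)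
  next
    case True
    with pq have "b \<noteq> d" by (simp add: p q)
    with pq 2 show ?thesis
      \<comment> \<open>The first frequency difference is 0, so all phases are 1 and the sum over
        cells folds back into one integral over \<open>cells\<close>.\<close>
      by (simp add: p q True set_integral_char_exp_borel_stack pairwise_def
          flip: set_integral_char_exp_cells)
  qed
qed

section \<open>Density of the product exponentials\<close>

lemma nn_integral_cells:
  assumes [measurable]: "g \<in> borel_measurable borel"
  shows "(\<integral>\<^sup>+y. indicator cells y * g y \<partial>lborel) = (\<Sum>j<n. \<integral>\<^sup>+y. indicator (cell (s j)) y * g y \<partial>lborel)"
proof -
  have "(\<integral>\<^sup>+y. indicator cells y * g y \<partial>lborel) = (\<integral>\<^sup>+y. (\<Sum>j<n. indicator (cell (s j)) y * g y) \<partial>lborel)"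
    by (simp only: indicator_cells sum_distrib_right)
  also have "\<dots> = (\<Sum>j<n. \<integral>\<^sup>+y. indicator (cell (s j)) y * g y \<partial>lborel)"
    by (intro nn_integral_sum) measurable
  finally show ?thesis .
qed

context
  fixes \<Lambda> :: "(real ^ 'd) set" and \<Gamma> :: "(real ^ 'k) set"
  assumes total_B: "E \<in> sets borel \<Longrightarrow>
      indicator E \<in> L2_closure (density lborel (indicator B)) (fun_span \<Lambda> char_exp)"
    and total_cells: "F \<in> sets borel \<Longrightarrow>
      indicator F \<in> L2_closure (density lborel (indicator cells)) (fun_span \<Gamma> char_exp)"
begin

abbreviation "stack_measure \<equiv> density lborel (indicator borel_stack)"

interpretation B: fun_subspace borel "fun_span \<Lambda> char_exp"
  by (intro fun_subspace_fun_span measurable_char_exp)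

interpretation cells: fun_subspace borel "fun_span \<Gamma> char_exp"
  by (intro fun_subspace_fun_span measurable_char_exp)

interpretation stack: fun_subspace stack_measure "fun_span (\<Lambda> \<times> \<Gamma>) char_exp"
  by (intro fun_subspace_fun_span) simp

text \<open>The factor in \<open>x\<close> has modulus 1, so the squared error on the stack is the
  error on \<open>cells\<close> times the measure of \<Omega>, whatever the shifts are.\<close>

lemma char_exp_times_in_closure:
  assumes "l \<in> \<Lambda>" and h: "h \<in> L2_closure (density lborel (indicator cells)) (fun_span \<Gamma> char_exp)"
  shows "(\<lambda>z. char_exp l (fst z) * h (snd z)) \<in> stack.cl"
proof (rule stack.closure_limit)
  have h_borel [measurable]: "h \<in> borel_measurable borel"
    using h by (simp add: L2_closure_def)
  have meas: "(\<lambda>z. char_exp l (fst z) * g (snd z)) \<in> borel_measurable borel"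
    if "g \<in> borel_measurable borel" for g :: "real ^ 'k \<Rightarrow> complex"
    using that by (intro measurable_product_function) auto
  then show "(\<lambda>z. char_exp l (fst z) * h (snd z)) \<in> borel_measurable stack_measure"
    using h_borel by simp
  fix \<epsilon> :: real assume "\<epsilon> > 0"
  define m where "m = measure lebesgue \<Omega>"
  have "m \<ge> 0" by (simp add: m_def)
  \<comment> \<open>The \<open>+ 1\<close> again yields a strict inequality and allows
    \<open>m = 0\<close>.\<close>
  define \<delta> where "\<delta> = \<epsilon> / (m + 1)"
  have "\<delta> > 0" using \<open>\<epsilon> > 0\<close> \<open>m \<ge> 0\<close> by (simp add: \<delta>_def)
  then obtain w where w: "w \<in> fun_span \<Gamma> char_exp"
    "sq_int (density lborel (indicator cells)) (\<lambda>y. h y - w y) < ennreal \<delta>"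
    using h by (auto simp: L2_closure_def)
  have w_borel [measurable]: "w \<in> borel_measurable borel" using w(1) by (rule cells.W_measurable)
  define g where "g = (\<lambda>z. char_exp l (fst z) * w (snd z))"
  have "g \<in> fun_span (\<Lambda> \<times> \<Gamma>) char_exp"
  proof -
    obtain J c where J: "w = (\<lambda>y. \<Sum>i\<in>J. c i * char_exp i y)" "finite J" "J \<subseteq> \<Gamma>"
      using w(1) by (auto simp: fun_span_def)
    \<comment> \<open>Multiplying by \<open>char_exp l\<close> attaches the first frequency
      \<open>l\<close> to every frequency of \<open>w\<close> and leaves the coefficients
      unchanged.\<close>
    have "g z = (\<Sum>p\<in>Pair l ` J. c (snd p) * char_exp p z)" for z
      using char_exp_Pair[of l _ "fst z" "snd z"]
      by (simp add: g_def J(1) sum.reindex inj_on_def sum_distrib_left mult_ac)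
    then show ?thesis
      unfolding fun_span_def using J assms(1)
      by (intro CollectI exI[of _ "Pair l ` J"] exI[of _ "\<lambda>p. c (snd p)"]) auto
  qed
  moreover have "sq_int stack_measure (\<lambda>z. char_exp l (fst z) * h (snd z) - g z) < ennreal \<epsilon>"
  proof -
    have "(\<lambda>z. char_exp l (fst z) * h (snd z) - g z) = (\<lambda>z. char_exp l (fst z) * (h (snd z) - w (snd z)))"
      by (simp add: g_def algebra_simps)
    then have "sq_int stack_measure (\<lambda>z. char_exp l (fst z) * h (snd z) - g z)
      = (\<integral>\<^sup>+z. indicator borel_stack z * ennreal ((norm (char_exp l (fst z) * (h (snd z) - w (snd z))))\<^sup>2) \<partial>lborel)"
      using meas[of "\<lambda>y. h y - w y"] by (simp only:) (intro sq_int_density_indicator, auto)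
    also have "\<dots> = (\<integral>\<^sup>+z. indicator borel_stack z * (1 * ennreal ((norm (h (snd z) - w (snd z)))\<^sup>2)) \<partial>lborel)"
      by (simp add: norm_mult)
    also have "\<dots> = (\<Sum>j<n. ennreal m * (\<integral>\<^sup>+y. indicator (cell (s j)) y * ennreal ((norm (h y - w y))\<^sup>2) \<partial>lborel))"
      by (subst nn_integral_borel_stack[of "\<lambda>_. 1" "\<lambda>y. ennreal ((norm (h y - w y))\<^sup>2)"])
        (simp_all add: emeasure_B m_def)
    also have "\<dots> = ennreal m * sq_int (density lborel (indicator cells)) (\<lambda>y. h y - w y)"
      by (simp add: sq_int_density_indicator nn_integral_cells sum_distrib_left)
    also have "\<dots> \<le> ennreal m * ennreal \<delta>"
      using w(2) by (intro mult_left_mono) auto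
    also have "\<dots> = ennreal (m * \<delta>)"
      using \<open>m \<ge> 0\<close> \<open>\<delta> > 0\<close> by (simp add: ennreal_mult)
    also have "\<dots> < ennreal \<epsilon>"
      using \<open>\<epsilon> > 0\<close> \<open>m \<ge> 0\<close> by (intro ennreal_lessI) (auto simp: \<delta>_def field_simps)
    finally show ?thesis .
  qed
  ultimately show "\<exists>g\<in>stack.cl. sq_int stack_measure (\<lambda>z. char_exp l (fst z) * h (snd z) - g z) < ennreal \<epsilon>"
    using stack.closure_superset by blast
qed

text \<open>Over the cell of \<open>s j\<close> the stack consists of one copy of \<open>B\<close>,
  shifted by \<open>v j\<close>. A single shift of the approximant therefore fits, and the error
  reduces to an approximation error on \<open>B\<close>.\<close>

lemma indicator_Times_cell_in_closure:
  assumes j: "j < n" and [measurable]: "E \<in> sets borel" "F \<in> sets borel"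
  shows "indicator (E \<times> (F \<inter> cell (s j))) \<in> stack.cl"
proof (rule stack.closure_limit)
  have "E \<times> (F \<inter> cell (s j)) \<in> sets borel"
    unfolding borel_prod[symmetric] by measurable
  then have [measurable]: "(indicator (E \<times> (F \<inter> cell (s j))) :: _ \<Rightarrow> complex) \<in> borel_measurable borel"
    by (rule borel_measurable_indicator)
  then show "(indicator (E \<times> (F \<inter> cell (s j))) :: _ \<Rightarrow> complex) \<in> borel_measurable stack_measure"
    by simp
  fix \<epsilon> :: real assume "\<epsilon> > 0"
  \<comment> \<open>\<open>E\<close> in the coordinates of the unshifted set \<open>B\<close>, where
    approximation by exponentials is available.\<close>
  define E' where "E' = (\<lambda>x. x + v j) -` E"
  have "E' \<in> sets borel"
    unfolding E'_def using measurable_sets[of "\<lambda>x. x + v j" borel borel E] by simp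
  then obtain P where P: "P \<in> fun_span \<Lambda> char_exp"
    "sq_int (density lborel (indicator B)) (\<lambda>x. indicator E' x - P x) < ennreal \<epsilon>"
    using total_B[of E'] \<open>\<epsilon> > 0\<close> by (auto simp: L2_closure_def)
  have [measurable]: "P \<in> borel_measurable borel" using P(1) by (rule B.W_measurable)
  note [measurable] = \<open>E' \<in> sets borel\<close>
  define w where "w = (\<lambda>z. P (fst z - v j) * indicator (F \<inter> cell (s j)) (snd z))"
  have "w \<in> stack.cl"
  proof -
    obtain J c where J: "P = (\<lambda>x. \<Sum>i\<in>J. c i * char_exp i x)" "finite J" "J \<subseteq> \<Lambda>"
      using P(1) by (auto simp: fun_span_def)
    have "(\<lambda>z. \<Sum>i\<in>J. (c i * char_exp i (- v j)) * (char_exp i (fst z) * indicator (F \<inter> cell (s j)) (snd z))) \<in> stack.cl"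
      using J(3) by (intro stack.closure_sum stack.closure_cmult char_exp_times_in_closure total_cells) auto
    \<comment> \<open>The shift becomes a constant factor of each term, so the frequencies stay in
      \<Lambda>.\<close>
    moreover have "char_exp i (x - v j) = char_exp i x * char_exp i (- v j)" for i x
      using char_exp_add_right[of i x "- v j"] by simp
    then have "w = (\<lambda>z. \<Sum>i\<in>J. (c i * char_exp i (- v j)) * (char_exp i (fst z) * indicator (F \<inter> cell (s j)) (snd z)))"
      by (simp only: w_def J(1) sum_distrib_right sum_distrib_left mult_ac)
    ultimately show ?thesis by simp
  qed
  moreover have "sq_int stack_measure (\<lambda>z. indicator (E \<times> (F \<inter> cell (s j))) z - w z) < ennreal \<epsilon>"
  proof -
    define f where "f = (\<lambda>x. ennreal ((norm (indicator E x - P (x - v j)))\<^sup>2))"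
    define g where "g = (indicator (F \<inter> cell (s j)) :: _ \<Rightarrow> ennreal)"
    have "(\<integral>\<^sup>+y. indicator (cell (s j)) y * g y \<partial>lborel) \<le> (\<integral>\<^sup>+y. indicator (cell (s j)) y \<partial>lborel)"
      by (intro nn_integral_mono) (simp add: g_def split: split_indicator)
    then have le_1: "(\<integral>\<^sup>+y. indicator (cell (s j)) y * g y \<partial>lborel) \<le> 1"
      by (simp add: emeasure_cell)
    have eq: "(\<lambda>z. indicator (E \<times> (F \<inter> cell (s j))) z - w z)
        = (\<lambda>z. (indicator E (fst z) - P (fst z - v j)) * indicator (F \<inter> cell (s j)) (snd z))"
      by (auto simp: w_def fun_eq_iff indicator_def)
    have "sq_int stack_measure (\<lambda>z. indicator (E \<times> (F \<inter> cell (s j))) z - w z)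
      = (\<integral>\<^sup>+z. indicator borel_stack z * ennreal ((norm ((indicator E (fst z) - P (fst z - v j)) * indicator (F \<inter> cell (s j)) (snd z)))\<^sup>2) \<partial>lborel)"
      unfolding eq by (intro sq_int_density_indicator borel_stack_borel
        measurable_product_function[of "\<lambda>x. indicator E x - P (x - v j)"]) measurable
    also have "\<dots> = (\<integral>\<^sup>+z. indicator borel_stack z * (f (fst z) * g (snd z)) \<partial>lborel)"
      by (intro nn_integral_cong) (auto simp: f_def g_def split: split_indicator)
    also have "\<dots> = (\<Sum>i<n. (\<integral>\<^sup>+x. indicator B x * f (x + v i) \<partial>lborel) * (\<integral>\<^sup>+y. indicator (cell (s i)) y * g y \<partial>lborel))"
      by (intro nn_integral_borel_stack) (auto simp: f_def g_def)
    \<comment> \<open>The other pieces lie over cells on which \<open>g\<close> vanishes.\<close>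
    also have "\<dots> = (\<Sum>i\<in>{j}. (\<integral>\<^sup>+x. indicator B x * f (x + v i) \<partial>lborel) * (\<integral>\<^sup>+y. indicator (cell (s i)) y * g y \<partial>lborel))"
    proof (intro sum.mono_neutral_right ballI)
      fix i assume i: "i \<in> {..<n} - {j}"
      then have "s i \<noteq> s j" using inj j by (auto dest: inj_onD)
      then have zero: "(\<lambda>y. indicator (cell (s i)) y * g y) = (\<lambda>_. 0)"
        by (auto simp: g_def cell_def indicator_def)
      show "(\<integral>\<^sup>+x. indicator B x * f (x + v i) \<partial>lborel) * (\<integral>\<^sup>+y. indicator (cell (s i)) y * g y \<partial>lborel) = 0"
        unfolding zero by simp
    qed (use j in auto)
    also have "\<dots> \<le> (\<integral>\<^sup>+x. indicator B x * f (x + v j) \<partial>lborel)"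
      using mult_left_mono[OF le_1, of "\<integral>\<^sup>+x. indicator B x * f (x + v j) \<partial>lborel"] by simp
    also have "\<dots> = sq_int (density lborel (indicator B)) (\<lambda>x. indicator E' x - P x)"
      by (subst sq_int_density_indicator) (auto simp: f_def E'_def indicator_def)
    also have "\<dots> < ennreal \<epsilon>" by (rule P(2))
    finally show ?thesis .
  qed
  ultimately show "\<exists>g\<in>stack.cl. sq_int stack_measure (\<lambda>z. indicator (E \<times> (F \<inter> cell (s j))) z - g z) < ennreal \<epsilon>"
    by blast
qed

text \<open>Every point of \<open>borel_stack\<close> lies over exactly one of the \<open>n\<close>
  cells, so cutting \<open>F\<close> along them loses nothing up to null sets of
  \<open>stack_measure\<close>.\<close>

lemma indicator_Times_in_closure:
  assumes [measurable]: "E \<in> sets borel" "F \<in> sets borel"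
  shows "indicator (E \<times> F) \<in> stack.cl"
proof (rule stack.closure_cong_AE)
  show "(\<lambda>z. \<Sum>j<n. indicator (E \<times> (F \<inter> cell (s j))) z) \<in> stack.cl"
    by (intro stack.closure_sum indicator_Times_cell_in_closure) auto
  have "E \<times> F \<in> sets borel"
    unfolding borel_prod[symmetric] by measurable
  then show "(indicator (E \<times> F) :: _ \<Rightarrow> complex) \<in> borel_measurable stack_measure"
    by simp
  have "indicator (E \<times> F) z = (\<Sum>j<n. indicator (E \<times> (F \<inter> cell (s j))) z :: complex)" if "z \<in> borel_stack" for z
  proof -
    have "(\<Sum>j<n. indicator (E \<times> (F \<inter> cell (s j))) z) = (\<Sum>j<n. indicator (E \<times> F) z * indicator (cell (s j)) (snd z) :: complex)"
      by (intro sum.cong refl) (auto simp: indicator_def split_beta mem_Times_iff)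
    also have "\<dots> = indicator (E \<times> F) z * indicator cells (snd z)"
      by (simp only: indicator_cells sum_distrib_left)
    finally have sum: "(\<Sum>j<n. indicator (E \<times> (F \<inter> cell (s j))) z) = (indicator (E \<times> F) z * indicator cells (snd z) :: complex)" .
    have "snd z \<in> cells"
      using that by (auto simp: borel_stack_def cells_def)
    then show ?thesis unfolding sum by simp
  qed
  moreover have "AE z in stack_measure. z \<in> borel_stack"
    by (subst AE_density) (auto intro!: AE_I2 split: split_indicator_asm)
  ultimately show "AE z in stack_measure. indicator (E \<times> F) z = (\<Sum>j<n. indicator (E \<times> (F \<inter> cell (s j))) z :: complex)"
    by (auto elim!: eventually_mono simp only:)
qed

text \<open>Borel rectangles form an intersection-stable generator of the Borel sets of the product,
  so the Dynkin argument extends the rectangle case.\<close>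

lemma indicator_in_closure_stack:
  assumes "A \<in> sets borel"
  shows "indicator A \<in> L2_closure (density lborel (indicator borel_stack)) (fun_span (\<Lambda> \<times> \<Gamma>) char_exp)"
proof (rule stack.closure_indicator_sigma_sets)
  let ?G = "{E \<times> F | E F. E \<in> sets (borel :: (real ^ 'd) measure) \<and> F \<in> sets (borel :: (real ^ 'k) measure)}"
  show "finite_measure stack_measure"
    by (rule finite_measureI) (simp add: emeasure_density emeasure_borel_stack)
  show "Int_stable ?G"
  proof (rule Int_stableI)
    fix a b assume "a \<in> ?G" "b \<in> ?G"
    then obtain E E' F F' where "a = E \<times> F" "b = E' \<times> F'" "E \<in> sets borel" "E' \<in> sets borel"
      "F \<in> sets borel" "F' \<in> sets borel" by blast
    then show "a \<inter> b \<in> ?G"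
      using Times_Int_Times[of E F E' F'] by blast
  qed
  show "?G \<subseteq> Pow (space stack_measure)" by auto
  show "sets stack_measure = sigma_sets (space stack_measure) ?G"
  proof -
    have "sets stack_measure = sets ((borel :: (real ^ 'd) measure) \<Otimes>\<^sub>M (borel :: (real ^ 'k) measure))"
      unfolding borel_prod by simp
    then show ?thesis unfolding sets_pair_measure by simp
  qed
  show "indicator (space stack_measure) \<in> stack.cl"
    using indicator_Times_in_closure[of UNIV UNIV] by simp
  show "indicator C \<in> stack.cl" if "C \<in> ?G" for C
    using that indicator_Times_in_closure by auto
  show "A \<in> sets stack_measure" using assms by simp
qed

end

text \<open>\<open>char_exp_basis_iff\<close> is used three times: it unpacks the bases on \<Omega>
  and \<open>cubes\<close> and assembles the one on the stack.\<close>

lemma spectral_stack: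
  assumes "spectral \<Omega>" "spectral cubes"
  shows "spectral stack"
proof -
  obtain \<Lambda> where \<Lambda>: "L2_orthogonal_basis (lebesgue_on \<Omega>) \<Lambda> char_exp"
    and pos: "measure lebesgue \<Omega> > 0"
    using assms(1) by (auto simp: spectral_def)
  obtain \<Gamma> where \<Gamma>: "L2_orthogonal_basis (lebesgue_on cubes) \<Gamma> char_exp"
    and cubes: "cubes \<in> lmeasurable" "measure lebesgue cubes > 0"
    using assms(2) by (auto simp: spectral_def)
  \<comment> \<open>With \<open>n = 0\<close> the set \<open>cubes\<close> would be empty,
    contradicting its positive measure.\<close>
  have "n > 0"
  proof (rule ccontr)
    assume "\<not> n > 0"
    then have "{..<n} = {}" by simp
    then have "cubes = {}" unfolding cubes_def by (simp add: set_plus_def)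
    with cubes(2) show False by simp
  qed
  then have pos': "measure lebesgue stack > 0"
    using pos by (simp add: measure_stack)
  note B = \<Lambda>[unfolded char_exp_basis_iff[OF lmeasurable pos B_borel AE_B]]
  note cells = \<Gamma>[unfolded char_exp_basis_iff[OF cubes cells_borel AE_cubes]]
  have "L2_orthogonal_basis (lebesgue_on stack) (\<Lambda> \<times> \<Gamma>) char_exp"
    unfolding char_exp_basis_iff[OF lmeasurable_stack pos' borel_stack_borel AE_stack]
    using B cells by (auto intro!: pairwise_orthogonal_borel_stack indicator_in_closure_stack)
  with pos' lmeasurable_stack show ?thesis by (auto simp: spectral_def)
qed

end

theorem theorem3p1:
  fixes \<Omega> :: "(real ^ 'd) set"
    and n :: nat
    and v :: "nat \<Rightarrow> real ^ 'd"
    and s :: "nat \<Rightarrow> int ^ 'k"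
    and X :: "((real ^ 'd) \<times> (real ^ 'k)) set"
    and S :: "(int ^ 'k) set"
    and \<Omega>' :: "((real ^ 'd) \<times> (real ^ 'k)) set"
  assumes "bounded \<Omega>"
    and "\<Omega> \<in> sets lebesgue"
    and "inj_on s {..<n}"
    and X_def: "X = (\<lambda>j. (v j, real_vec (s j))) ` {..<n}"
    and S_def: "S = s ` {..<n}"
    and \<Omega>'_def: "\<Omega>' = (\<Omega> \<times> cbox 0 1) + X"
  shows "(tiles_lattice S \<longrightarrow> (tiles_space \<Omega>' \<longleftrightarrow> tiles_space \<Omega>)) \<and>
         (spectral \<Omega> \<and> spectral (real_vec ` S + cbox 0 1) \<longrightarrow> spectral \<Omega>')"
proof -
  \<comment> \<open>Boundedness provides the finite measure demanded by
    \<open>stacked_set\<close>.\<close>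
  have "\<Omega> \<in> lmeasurable"
    using assms(1,2) by (rule bounded_set_imp_lmeasurable)
  obtain B where "B \<in> sets borel" "AE x in lborel. x \<in> \<Omega> \<longleftrightarrow> x \<in> B"
    using assms(2) by (rule AE_borel_representative)
  interpret stacked_set \<Omega> B n v s
    by unfold_locales fact+
  have stack: "stack = \<Omega>'" by (simp add: stack_def \<Omega>'_def X_def)
  show ?thesis
    using tiles_space_stack tiles_space_base spectral_stack
    unfolding stack S_def cubes_def by blast
qed

end
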